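(* Let $q\ge1$, $m\ge1$, $n\in\{2m,2m+1\}$, and let $\mathbf f_n(z)=I_qz^n+A_1z^{n-1}+\cdots+A_n$ ($A_j\in\mathbb C^{q\times q}$, $A_0:=I_q$) be a Hurwitz-type matrix polynomial with Markov parameters $(s_j)_{j\ge0}$, where $s_0,\dots,s_{n-1}$ is a Stieltjes positive sequence. Let $T_m$, $v_m$, $u_{1,m}$, $u_{2,m}$, $\Sigma_{1,m}$, $\Sigma_{2,m}$, $P_{k,m}$, $Q_{k,m}$ be as defined in the context. If $n=2m$, then $$A_{2j}=(-1)^{j}\,v_m^*(T_m^{m-j})^*\Sigma_{1,m},\quad j=0,1,\dots,m,$$ $$A_{2j+1}=(-1)^{j+1}\,u_{1,m}^*(T_m^{m-j-1})^*\Sigma_{1,m},\quad j=0,1,\dots,m-1.$$ If $n=2m+1$, then $$A_{2j}=(-1)^{j}\,v_m^*(T_m^{m-j})^*\Sigma_{2,m},\qquad A_{2j+1}=(-1)^{j+1}\,u_{2,m}^*(T_m^{m-j})^*\Sigma_{2,m},\quad j=0,1,\dots,m.$$ In particular, for $n=2m$, $$I_q=v_m^*(T_m^m)^*\Sigma_{1,m},\qquad A_1=-u_{1,m}^*(T_m^{m-1})^*\Sigma_{1,m}=s_0,$$ $$A_{2m-1}=(-1)^mu_{1,m}^*\Sigma_{1,m}=(-1)^{m+1}Q_{1,m}(0)^*,\qquad A_{2m}=(-1)^mv_m^*\Sigma_{1,m}=(-1)^mP_{1,m}(0)^*,$$ and for $n=2m+1$, $$I_q=v_m^*(T_m^m)^*\Sigma_{2,m},\qquad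 A_1=-u_{2,m}^*(T_m^m)^*\Sigma_{2,m}=s_0,$$ $$A_{2m}=(-1)^mv_m^*\Sigma_{2,m}=(-1)^mP_{2,m}(0)^*,\qquad A_{2m+1}=(-1)^{m+1}u_{2,m}^*\Sigma_{2,m}=(-1)^mQ_{2,m}(0)^*.$$
   Context: **Hurwitz-type matrix (HTM) polynomials.** Write $\mathbf f_n(z)=\mathbf h_n(z^2)+z\,\mathbf g_n(z^2)$, where for $n=2m$: $\mathbf h_n(z)=I_qz^m+A_2z^{m-1}+\cdots+A_{2m}$, $\mathbf g_n(z)=A_1z^{m-1}+A_3z^{m-2}+\cdots+A_{2m-1}$; and for $n=2m+1$: $\mathbf h_n(z)=A_1z^m+A_3z^{m-1}+\cdots+A_{2m+1}$, $\mathbf g_n(z)=I_qz^m+A_2z^{m-1}+\cdots+A_{2m}$. $\mathbf f_n$ is an HTM polynomial if there are Hermitian positive definite $q\times q$ matrices $\mathbf c_0,\dots,\mathbf c_{m-1},\mathbf d_0,\dots,\mathbf d_{m-1}$ if $n=2m$ (resp. $\mathbf c_0,\dots,\mathbf c_m,\mathbf d_0,\dots,\mathbf d_{m-1}$ if $n=2m+1$) such that, as an identity of rational matrix functions, $\mathbf g_n(z)\mathbf h_n(z)^{-1}=K_0(z)$ (resp. $\mathbf h_n(z)(z\mathbf g_n(z))^{-1}=K_0(z)$), where $K_{m-1}(z)=(z\mathbf c_{m-1}+\mathbf d_{m-1}^{-1})^{-1}$ and $K_i(z)=\bigl(z\mathbf c_i+(\mathbf d_i+K_{i+1}(z))^{-1}\bigr)^{-1}$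 for $i=m-2,\dots,0$ (resp. $K_m(z)=z^{-1}\mathbf c_m^{-1}$ and $K_i(z)=\bigl(z\mathbf c_i+(\mathbf d_i+K_{i+1}(z))^{-1}\bigr)^{-1}$ for $i=m-1,\dots,0$). **Markov parameters.** The Markov parameters $s_j\in\mathbb C^{q\times q}$ of $\mathbf f_n$ are defined by the Laurent expansion at infinity $\sum_{j\ge0}(-1)^js_jz^{-j-1}$ of $\mathbf g_n(z)\mathbf h_n(z)^{-1}$ if $n=2m$, resp. of $\mathbf h_n(z)(z\mathbf g_n(z))^{-1}$ if $n=2m+1$. **Block Hankel matrices.** $H_{1,j}=(s_{a+b})_{a,b=0}^{j}$, $H_{2,j}=(s_{a+b+1})_{a,b=0}^{j}$. A sequence $(s_j)_{j=0}^{\kappa}$ is Stieltjes positive if $H_{1,j}$ is Hermitian positive definite whenever $2j\le\kappa$ and $H_{2,j}$ is Hermitian positive definite whenever $2j+1\le\kappa$. Put $y_{[j,k]}=(s_j,s_{j+1},\dots,s_k)^*$ (block column), and for $j\ge1$: $Y_{1,j}=y_{[j,2j-1]}$, $Y_{2,j}=y_{[j+1,2j]}$. **Further matrices** ($j\ge1$). $T_j=\begin{pmatrix}0_{q\times jq}&0_q\\ I_{jq}&0_{jq\times q}\end{pmatrix}$, $v_j=\begin{pmatrix}I_q\\0_{jq\times q}\end{pmatrix}$, $u_{1,j}=\begin{pmatrix}0_q\\-y_{[0,j-1]}\end{pmatrix}$, $u_{2,j}=-y_{[0,j]}$, $R_j(z)=(I_{(j+1)q}-zT_j)^{-1}$,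 and $\Sigma_{r,j}=\begin{pmatrix}-H_{r,j-1}^{-1}Y_{r,j}\\ I_q\end{pmatrix}$, $r=1,2$. **Matrix polynomials** ($j\ge1$). For $r=1,2$: $P_{r,j}(z)=(-Y_{r,j}^*H_{r,j-1}^{-1},\,I_q)R_j(z)v_j$ and $Q_{r,j}(z)=-(-Y_{r,j}^*H_{r,j-1}^{-1},\,I_q)R_j(z)u_{r,j}$. *)

theory Defs
  imports
    Complex_Main
    "HOL-Computational_Algebra.Fraction_Field"
    "HOL-Computational_Algebra.Polynomial_Factorial"
    "Jordan_Normal_Form.Gauss_Jordan_Elimination"
    "Jordan_Normal_Form.Schur_Decomposition"
begin

section \<open>Matrices\<close>

text \<open>Unspecified on singular matrices.\<close>

definition minv :: "'a :: field mat \<Rightarrow> 'a mat" where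
  "minv A = the (mat_inverse A)"

definition hermitian_pos_def :: "nat \<Rightarrow> complex mat \<Rightarrow> bool" where
  "hermitian_pos_def k A \<longleftrightarrow>
     A \<in> carrier_mat k k \<and> mat_adjoint A = A \<and>
     (\<forall>x \<in> carrier_vec k. x \<noteq> 0\<^sub>v k \<longrightarrow> 0 < (A *\<^sub>v x) \<bullet>c x)"

text \<open>Block matrix with \<open>r\<close> times \<open>c\<close> blocks, the block in position \<open>(a, b)\<close> being the
  \<open>q\<close> times \<open>q\<close> matrix \<open>B a b\<close>; block indices start at 0.\<close>

definition block_mat :: "nat \<Rightarrow> nat \<Rightarrow> nat \<Rightarrow> (nat \<Rightarrow> nat \<Rightarrow> complex mat) \<Rightarrow> complex mat" where
  "block_mat q r c B =
     mat (r * q) (c * q) (\<lambda>(i, j). B (i div q) (j div q) $$ (i mod q, j mod q))"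

definition append_cols :: "'a :: zero mat \<Rightarrow> 'a mat \<Rightarrow> 'a mat" where
  "append_cols A B = four_block_mat A B (0\<^sub>m 0 (dim_col A)) (0\<^sub>m 0 (dim_col B))"


section \<open>Matrix polynomials and rational matrix functions\<close>

text \<open>A matrix polynomial is a matrix with polynomial entries, and a rational matrix function is
  a matrix over the field \<open>complex poly fract\<close> of rational functions.  Coefficient sequences are
  indexed from the leading coefficient downwards:
  \<open>matpoly q d C\<close> is $C_0 z^d + C_1 z^{d-1} + \cdots + C_d$.\<close>

definition matpoly :: "nat \<Rightarrow> nat \<Rightarrow> (nat \<Rightarrow> complex mat) \<Rightarrow> complex poly mat" where
  "matpoly q d C = mat q q (\<lambda>(a, b). \<Sum>k\<le>d. monom (C k $$ (a, b)) (d - k))"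

definition peval :: "complex poly mat \<Rightarrow> complex \<Rightarrow> complex mat" where
  "peval M z = map_mat (\<lambda>p. poly p z) M"

definition rat_of_polymat :: "complex poly mat \<Rightarrow> complex poly fract mat" where
  "rat_of_polymat = map_mat to_fract"

definition rat_of_mat :: "complex mat \<Rightarrow> complex poly fract mat" where
  "rat_of_mat = map_mat (\<lambda>c. to_fract [:c:])"

definition rat_z :: "complex poly fract" where
  "rat_z = to_fract [:0, 1:]"


section \<open>Hurwitz-type matrix polynomials\<close>

text \<open>The polynomial $f_n(z) = A_0 z^n + A_1 z^{n-1} + \cdots + A_n$ is given by its coefficient
  sequence \<open>A\<close>; its leading coefficient \<open>A 0\<close> is meant to be the identity.\<close>

definition f_poly :: "nat \<Rightarrow> nat \<Rightarrow> (nat \<Rightarrow> complex mat) \<Rightarrow> complex poly mat" where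
  "f_poly q n A = matpoly q n A"

definition h_poly :: "nat \<Rightarrow> nat \<Rightarrow> (nat \<Rightarrow> complex mat) \<Rightarrow> complex poly mat" where
  "h_poly q n A =
     (if even n then matpoly q (n div 2) (\<lambda>k. A (2 * k))
      else matpoly q (n div 2) (\<lambda>k. A (2 * k + 1)))"

definition g_poly :: "nat \<Rightarrow> nat \<Rightarrow> (nat \<Rightarrow> complex mat) \<Rightarrow> complex poly mat" where
  "g_poly q n A =
     (if even n then matpoly q (n div 2 - 1) (\<lambda>k. A (2 * k + 1))
      else matpoly q (n div 2) (\<lambda>k. A (2 * k)))"

lemma f_poly_decomposition:
  assumes "n \<ge> 2" "a < q" "b < q"
  shows "poly (f_poly q n A $$ (a, b)) z =
    poly (h_poly q n A $$ (a, b)) (z\<^sup>2) + z * poly (g_poly q n A $$ (a, b)) (z\<^sup>2)"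
proof -
  have split_odd: "(\<Sum>k\<le>2 * p + 1. F k) = (\<Sum>k\<le>p. F (2 * k)) + (\<Sum>k\<le>p. F (2 * k + 1))"
    for p and F :: "nat \<Rightarrow> complex"
    by (induction p) (simp_all add: numeral_eq_Suc)
  have entry: "poly (matpoly q d C $$ (a, b)) x = (\<Sum>k\<le>d. C k $$ (a, b) * x ^ (d - k))" for d C x
    using assms by (simp add: matpoly_def poly_sum poly_monom)
  define F where "F k = A k $$ (a, b) * z ^ (n - k)" for k
  define m where "m = n div 2"
  have m: "m \<ge> 1" using assms by (simp add: m_def)
  have pow: "(z\<^sup>2) ^ k = z ^ (2 * k)" for k by (simp add: power_mult)
  have zpow: "z * (x * z ^ k) = x * z ^ (Suc k)" for x k by simp
  show ?thesis
  proof (cases "even n")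
    case True
    then have n: "n = 2 * m" by (simp add: m_def)
    then have n': "n = Suc (2 * (m - 1) + 1)" using m by simp
    have "(\<Sum>k\<le>n. F k) =
        (\<Sum>k\<le>m - 1. F (2 * k)) + (\<Sum>k\<le>m - 1. F (2 * k + 1)) + F (2 * m)"
      unfolding n' sum.atMost_Suc split_odd using m n by (cases m) simp_all
    also have "(\<Sum>k\<le>m - 1. F (2 * k)) + (\<Sum>k\<le>m - 1. F (2 * k + 1)) + F (2 * m) =
        (\<Sum>k\<le>m. F (2 * k)) + (\<Sum>k\<le>m - 1. F (2 * k + 1))"
      using m by (cases m) simp_all
    also have "(\<Sum>k\<le>m. F (2 * k)) = poly (h_poly q n A $$ (a, b)) (z\<^sup>2)"
      unfolding h_poly_def using True
      by (simp add: entry pow F_def n diff_mult_distrib2)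
    also have "(\<Sum>k\<le>m - 1. F (2 * k + 1)) = z * poly (g_poly q n A $$ (a, b)) (z\<^sup>2)"
    proof -
      have "n - (2 * k + 1) = Suc (2 * (m - 1 - k))" if "k \<le> m - 1" for k
        using that m n by simp
      then show ?thesis unfolding g_poly_def using True
        by (simp add: entry pow F_def sum_distrib_left zpow flip: m_def del: power_Suc)
    qed
    finally show ?thesis by (simp add: f_poly_def entry F_def)
  next
    case False
    then have n: "n = 2 * m + 1" by (simp add: m_def)
    have "(\<Sum>k\<le>n. F k) = (\<Sum>k\<le>m. F (2 * k)) + (\<Sum>k\<le>m. F (2 * k + 1))"
      unfolding n split_odd ..
    also have "(\<Sum>k\<le>m. F (2 * k + 1)) = poly (h_poly q n A $$ (a, b)) (z\<^sup>2)"
      unfolding h_poly_def using False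
      by (simp add: entry pow F_def n diff_mult_distrib2)
    also have "(\<Sum>k\<le>m. F (2 * k)) = z * poly (g_poly q n A $$ (a, b)) (z\<^sup>2)"
    proof -
      have "n - 2 * k = Suc (2 * (m - k))" if "k \<le> m" for k
        using that n by simp
      then show ?thesis unfolding g_poly_def using False
        by (simp add: entry pow F_def sum_distrib_left zpow flip: m_def del: power_Suc)
    qed
    finally show ?thesis by (simp add: f_poly_def entry F_def)
  qed
qed

definition htm_polynomial :: "nat \<Rightarrow> nat \<Rightarrow> (nat \<Rightarrow> complex mat) \<Rightarrow> bool" where
  "htm_polynomial q n A \<longleftrightarrow>
    (let m = n div 2;
         h = rat_of_polymat (h_poly q n A);
         g = rat_of_polymat (g_poly q n A)
     in \<exists>(c :: nat \<Rightarrow> complex mat) (d :: nat \<Rightarrow> complex mat) (K :: nat \<Rightarrow> complex poly fract mat).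
       (if even n then
          (\<forall>i<m. hermitian_pos_def q (c i)) \<and> (\<forall>i<m. hermitian_pos_def q (d i)) \<and>
          K (m - 1) = minv (rat_z \<cdot>\<^sub>m rat_of_mat (c (m - 1)) + rat_of_mat (minv (d (m - 1)))) \<and>
          (\<forall>i<m - 1. K i =
             minv (rat_z \<cdot>\<^sub>m rat_of_mat (c i) + minv (rat_of_mat (d i) + K (i + 1)))) \<and>
          g * minv h = K 0
        else
          (\<forall>i\<le>m. hermitian_pos_def q (c i)) \<and> (\<forall>i<m. hermitian_pos_def q (d i)) \<and>
          K m = inverse rat_z \<cdot>\<^sub>m rat_of_mat (minv (c m)) \<and>
          (\<forall>i<m. K i =
             minv (rat_z \<cdot>\<^sub>m rat_of_mat (c i) + minv (rat_of_mat (d i) + K (i + 1)))) \<and>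
          h * minv (rat_z \<cdot>\<^sub>m g) = K 0))"


section \<open>Markov parameters and block Hankel matrices\<close>

definition markov_function :: "nat \<Rightarrow> nat \<Rightarrow> (nat \<Rightarrow> complex mat) \<Rightarrow> complex \<Rightarrow> complex mat" where
  "markov_function q n A z =
     (if even n then peval (g_poly q n A) z * minv (peval (h_poly q n A) z)
      else peval (h_poly q n A) z * minv (z \<cdot>\<^sub>m peval (g_poly q n A) z))"

text \<open>The Laurent expansion at infinity is read as entrywise convergence for all \<open>z\<close> of
  sufficiently large modulus.\<close>

definition markov_parameters ::
    "nat \<Rightarrow> nat \<Rightarrow> (nat \<Rightarrow> complex mat) \<Rightarrow> (nat \<Rightarrow> complex mat) \<Rightarrow> bool" where
  "markov_parameters q n A s \<longleftrightarrow>
     (\<forall>j. s j \<in> carrier_mat q q) \<and>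
     (\<forall>\<^sub>F z in at_infinity. \<forall>a<q. \<forall>b<q.
        (\<lambda>j. (-1) ^ j * s j $$ (a, b) / z ^ (j + 1)) sums (markov_function q n A z $$ (a, b)))"

text \<open>Here and below the index \<open>r\<close> ranges over \<open>{1, 2}\<close>.\<close>

definition hankel :: "nat \<Rightarrow> (nat \<Rightarrow> complex mat) \<Rightarrow> nat \<Rightarrow> nat \<Rightarrow> complex mat" where
  "hankel q s r j =
     block_mat q (j + 1) (j + 1) (\<lambda>a b. if r = 1 then s (a + b) else s (a + b + 1))"

definition stieltjes_positive :: "nat \<Rightarrow> (nat \<Rightarrow> complex mat) \<Rightarrow> nat \<Rightarrow> bool" where
  "stieltjes_positive q s \<kappa> \<longleftrightarrow>
     (\<forall>j. 2 * j \<le> \<kappa> \<longrightarrow> hermitian_pos_def ((j + 1) * q) (hankel q s 1 j)) \<and>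
     (\<forall>j. 2 * j + 1 \<le> \<kappa> \<longrightarrow> hermitian_pos_def ((j + 1) * q) (hankel q s 2 j))"

text \<open>$y_{[j,k]} = (s_j, \ldots, s_k)^*$: the adjoint of a block row, hence a block column.\<close>

definition y_col :: "nat \<Rightarrow> (nat \<Rightarrow> complex mat) \<Rightarrow> nat \<Rightarrow> nat \<Rightarrow> complex mat" where
  "y_col q s j k = mat_adjoint (block_mat q 1 (k + 1 - j) (\<lambda>_ b. s (j + b)))"

definition Y_mat :: "nat \<Rightarrow> (nat \<Rightarrow> complex mat) \<Rightarrow> nat \<Rightarrow> nat \<Rightarrow> complex mat" where
  "Y_mat q s r j = (if r = 1 then y_col q s j (2 * j - 1) else y_col q s (j + 1) (2 * j))"


section \<open>The matrices entering the representation\<close>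

definition T_mat :: "nat \<Rightarrow> nat \<Rightarrow> complex mat" where
  "T_mat q j = four_block_mat (0\<^sub>m q (j * q)) (0\<^sub>m q q) (1\<^sub>m (j * q)) (0\<^sub>m (j * q) q)"

definition v_mat :: "nat \<Rightarrow> nat \<Rightarrow> complex mat" where
  "v_mat q j = 1\<^sub>m q @\<^sub>r 0\<^sub>m (j * q) q"

definition u_mat :: "nat \<Rightarrow> (nat \<Rightarrow> complex mat) \<Rightarrow> nat \<Rightarrow> nat \<Rightarrow> complex mat" where
  "u_mat q s r j =
     (if r = 1 then 0\<^sub>m q q @\<^sub>r (- y_col q s 0 (j - 1)) else - y_col q s 0 j)"

definition R_mat :: "nat \<Rightarrow> nat \<Rightarrow> complex \<Rightarrow> complex mat" where
  "R_mat q j z = minv (1\<^sub>m ((j + 1) * q) - z \<cdot>\<^sub>m T_mat q j)"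

definition Sigma_mat :: "nat \<Rightarrow> (nat \<Rightarrow> complex mat) \<Rightarrow> nat \<Rightarrow> nat \<Rightarrow> complex mat" where
  "Sigma_mat q s r j = (- (minv (hankel q s r (j - 1)) * Y_mat q s r j)) @\<^sub>r 1\<^sub>m q"

definition P_mat :: "nat \<Rightarrow> (nat \<Rightarrow> complex mat) \<Rightarrow> nat \<Rightarrow> nat \<Rightarrow> complex \<Rightarrow> complex mat" where
  "P_mat q s r j z =
     append_cols (- (mat_adjoint (Y_mat q s r j) * minv (hankel q s r (j - 1)))) (1\<^sub>m q)
       * R_mat q j z * v_mat q j"

definition Q_mat :: "nat \<Rightarrow> (nat \<Rightarrow> complex mat) \<Rightarrow> nat \<Rightarrow> nat \<Rightarrow> complex \<Rightarrow> complex mat" where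
  "Q_mat q s r j z =
     - (append_cols (- (mat_adjoint (Y_mat q s r j) * minv (hankel q s r (j - 1)))) (1\<^sub>m q)
       * R_mat q j z * u_mat q s r j)"

end

theory Submission
  imports Defs
begin

text \<open>
  Write $n = 2m + e$ with $e \in \{0, 1\}$ and substitute $w = 1/z$.  In both parities the quotient
  that defines the Markov parameters becomes, after powers of $z$ cancel,
  \[ \Bigl(\sum_{j \ge 0} (-1)^j s_j w^j\Bigr) \Bigl(\sum_{k \le m} A_{2k} w^k\Bigr)
      = \sum_{2p + 1 \le n} A_{2p+1} w^p . \]
  The denominator is the factor with the even coefficients; it is invertible for small $w$ since
  its value at $w = 0$ is $A_0 = I_q$.  Comparing the coefficients of $w^p$ gives
  \[ \sum_{k \le \min(p, m)} (-1)^{p-k} s_{p-k} A_{2k} =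
      A_{2p+1} \mbox{ if } 2p + 1 \le n, \mbox{ and } 0 \mbox{ otherwise} \]
  (\<open>markov_recurrence\<close>), and the whole theorem is read off from this recurrence.

  Put $Z_l = (-1)^{m-l} A_{2(m-l)}$.  The $m$ rows $p = m + e, \ldots, 2m + e - 1$, whose right-hand
  side is zero, say that the block column $(Z_0, \ldots, Z_{m-1})$ solves the block Hankel system
  with matrix $H_{e+1,m-1}$ and right-hand side $-Y_{e+1,m}$; here $s_j^* = s_j$ is used, because
  $Y_{e+1,m}$ is made of adjoints.  The Hankel matrix is positive definite, hence invertible, and
  $Z_m = A_0 = I_q$, so $\Sigma_{e+1,m}$ is exactly the block column $(Z_0, \ldots, Z_m)$
  (\<open>Sigma_mat_block_col\<close>).  This already contains the even coefficients.

  The nilpotent matrix $T_m$ shifts block columns down, so multiplying $\Sigma$ by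
  $x^* (T_m^k)^*$ pairs the blocks of $x$ with those of $\Sigma$ from the $k$-th on
  (\<open>shifted_block_col_pairing\<close>).  For $x = v_m$ this picks out the block $Z_k$.  For
  $x = u_{e+1,m}$, whose blocks are $-s_l^*$, preceded by a zero block if $e = 0$, it reproduces the left-hand side of the rows with
  $2p + 1 \le n$, that is, the odd coefficients.  The values $P(0)$ and $Q(0)$ reduce to the same
  pairings because $R_m(0)$ is the identity and $(-Y^* H^{-1}, I_q) = \Sigma^*$.
\<close>


section \<open>Uniqueness of power series coefficients\<close>

text \<open>The sum is prescribed only off the origin, which is all that a Laurent expansion at
  infinity provides after $w = 1/z$.  Divide the difference by the power of $w$ that is known to
  cancel and let $w$ tend to 0.\<close>

lemma power_series_coeff_unique:
  fixes a b :: "nat \<Rightarrow> complex"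
  assumes r: "0 < r"
    and a: "\<And>w. w \<noteq> 0 \<Longrightarrow> norm w < r \<Longrightarrow> (\<lambda>n. a n * w ^ n) sums f w"
    and b: "\<And>w. w \<noteq> 0 \<Longrightarrow> norm w < r \<Longrightarrow> (\<lambda>n. b n * w ^ n) sums f w"
  shows "a n = b n"
proof (induction n rule: less_induct)
  case (less n)
  have tail: "(\<lambda>k. (a (k + n) - b (k + n)) * w ^ k) sums 0" if w: "w \<noteq> 0" "norm w < r" for w
  proof -
    have "(\<lambda>k. (a k - b k) * w ^ k) sums (f w - f w)"
      using sums_diff[OF a[OF w] b[OF w]] by (simp add: left_diff_distrib)
    then have "(\<lambda>k. (a (k + n) - b (k + n)) * w ^ (k + n)) sums 0"
      by (subst sums_iff_shift) (simp add: less.IH)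
    then have "(\<lambda>k. (a (k + n) - b (k + n)) * w ^ (k + n) / w ^ n) sums (0 / w ^ n)"
      by (rule sums_divide)
    then show ?thesis using w by (simp add: power_add)
  qed
  have "((\<lambda>_. 0) \<longlongrightarrow> a (0 + n) - b (0 + n)) (at (0 :: complex))"
    by (rule powser_limit_0_strong[OF r]) (rule tail)
  then have "0 = a (0 + n) - b (0 + n)"
    by (simp only: tendsto_const_iff at_neq_bot not_False_eq_True)
  then show ?case by simp
qed

section \<open>Inverses, entries and adjoints of matrices\<close>

lemma minv_inverts:
  fixes A :: "'a :: field mat"
  assumes A: "A \<in> carrier_mat k k" and det: "det A \<noteq> 0"
  shows "A * minv A = 1\<^sub>m k" "minv A * A = 1\<^sub>m k" "minv A \<in> carrier_mat k k"
proof -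
  have "A \<in> Units (ring_mat TYPE('a) k ())" by (rule det_non_zero_imp_unit[OF A det])
  then obtain B where "mat_inverse A = Some B"
    using mat_inverse(1)[OF A, where b = "()"] by (cases "mat_inverse A") auto
  then show "A * minv A = 1\<^sub>m k" "minv A * A = 1\<^sub>m k" "minv A \<in> carrier_mat k k"
    using mat_inverse(2)[OF A] by (simp_all add: minv_def)
qed

lemma mult_mat_entry:
  assumes "A \<in> carrier_mat n k" "B \<in> carrier_mat k m" "i < n" "j < m"
  shows "(A * B) $$ (i, j) = (\<Sum>l<k. A $$ (i, l) * B $$ (l, j))"
  using assms by (simp add: scalar_prod_def lessThan_atLeast0)

lemma smult_mat_entry:
  assumes "M \<in> carrier_mat n k" "i < n" "j < k"
  shows "(x \<cdot>\<^sub>m M) $$ (i, j) = x * M $$ (i, j)"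
  using carrier_matD[OF assms(1)] assms(2,3) by simp

lemma mat_adjoint_carrier [simp]: "A \<in> carrier_mat n k \<Longrightarrow> mat_adjoint A \<in> carrier_mat k n"
  by (auto simp: mat_adjoint_def)

lemma mat_adjoint_dim [simp]:
  "dim_row (mat_adjoint A) = dim_col A" "dim_col (mat_adjoint A) = dim_row A"
  by (auto simp: mat_adjoint_def)

lemma mat_adjoint_entry [simp]:
  fixes A :: "complex mat"
  shows "i < dim_col A \<Longrightarrow> j < dim_row A \<Longrightarrow> mat_adjoint A $$ (i, j) = cnj (A $$ (j, i))"
  by (simp add: mat_adjoint_def mat_of_rows_index)

lemma mat_adjoint_mult:
  fixes A B :: "complex mat"
  assumes A: "A \<in> carrier_mat n k" and B: "B \<in> carrier_mat k p"
  shows "mat_adjoint (A * B) = mat_adjoint B * mat_adjoint A"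
proof (rule eq_matI)
  fix i j assume "i < dim_row (mat_adjoint B * mat_adjoint A)" "j < dim_col (mat_adjoint B * mat_adjoint A)"
  then have ij: "i < p" "j < n" using A B by auto
  show "mat_adjoint (A * B) $$ (i, j) = (mat_adjoint B * mat_adjoint A) $$ (i, j)"
    using A B ij
    by (auto simp: mult_mat_entry[OF A B] mult_mat_entry[OF mat_adjoint_carrier[OF B] mat_adjoint_carrier[OF A]]
        mult.commute simp del: index_mult_mat(1) intro!: sum.cong)
qed (use A B in auto)

lemma mat_adjoint_adjoint [simp]: "mat_adjoint (mat_adjoint A) = (A :: complex mat)"
  by (rule eq_matI) auto

lemma mat_adjoint_one [simp]: "mat_adjoint (1\<^sub>m n) = (1\<^sub>m n :: complex mat)"
  by (rule eq_matI) auto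

lemma mat_adjoint_zero [simp]: "mat_adjoint (0\<^sub>m n k) = (0\<^sub>m k n :: complex mat)"
  by (rule eq_matI) auto

section \<open>Block columns\<close>

lemma sum_over_blocks:
  fixes f :: "nat \<Rightarrow> 'a :: comm_monoid_add"
  shows "(\<Sum>i<r * q. f i) = (\<Sum>l<r. \<Sum>b<q. f (l * q + b))"
proof -
  have "sum f {l * q..<l * q + q} = (\<Sum>b<q. f (l * q + b))" for l
    using sum.shift_bounds_nat_ivl[of f 0 "l * q" q]
    by (simp add: lessThan_atLeast0 add.commute)
  then show ?thesis by (simp flip: sum.nat_group)
qed

lemma block_index_less:
  fixes l r b q :: nat
  assumes "l < r" "b < q"
  shows "l * q + b < r * q"
proof -
  have "l * q + b < Suc l * q" using assms by simp
  also have "\<dots> \<le> r * q" using assms by (intro mult_right_mono) auto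
  finally show ?thesis .
qed

text \<open>The matrices $v_m$, $u_{r,m}$, $Y_{r,m}$ and $\Sigma_{r,m}$ are all block columns, and the Hankel
  matrices and $T_m$ act on block columns blockwise.\<close>

definition block_col :: "nat \<Rightarrow> nat \<Rightarrow> (nat \<Rightarrow> complex mat) \<Rightarrow> complex mat" where
  "block_col q r X = mat (r * q) q (\<lambda>(i, c). X (i div q) $$ (i mod q, c))"

lemma block_col_carrier [simp]: "block_col q r X \<in> carrier_mat (r * q) q"
  and block_col_dim [simp]: "dim_row (block_col q r X) = r * q" "dim_col (block_col q r X) = q"
  by (simp_all add: block_col_def)

lemma block_col_entry [simp]:
  assumes "l < r" "b < q" "c < q"
  shows "block_col q r X $$ (l * q + b, c) = X l $$ (b, c)"
  using assms by (simp add: block_col_def block_index_less)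

lemma block_col_eqI:
  assumes M: "M \<in> carrier_mat (r * q) q"
    and entry: "\<And>l b c. l < r \<Longrightarrow> b < q \<Longrightarrow> c < q \<Longrightarrow> M $$ (l * q + b, c) = X l $$ (b, c)"
  shows "M = block_col q r X"
proof (rule eq_matI)
  fix i c assume "i < dim_row (block_col q r X)" "c < dim_col (block_col q r X)"
  then have ic: "i < r * q" "c < q" by simp_all
  then have q: "q > 0" by simp
  have "i div q < r" using ic q by (simp add: div_less_iff_less_mult)
  then show "M $$ (i, c) = block_col q r X $$ (i, c)"
    using entry[of "i div q" "i mod q" c] ic q by (simp add: block_col_def)
qed (use M in auto)

text \<open>Both Hankel matrices at once: with \<open>e\<close> equal to 0 or 1 the index $r$ is $e + 1$, and the block
  in position $(a, b)$ is $s_{a+b+e}$.\<close>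

lemma hankel_mult_block_col:
  assumes s: "\<And>j. s j \<in> carrier_mat q q" and X: "\<And>l. l < r \<Longrightarrow> X l \<in> carrier_mat q q"
    and r: "r > 0" and e: "e \<le> 1" and i: "i < r" and bc: "b < q" "c < q"
  shows "(hankel q s (e + 1) (r - 1) * block_col q r X) $$ (i * q + b, c) =
    (\<Sum>l<r. (s (i + l + e) * X l) $$ (b, c))"
proof -
  have H: "hankel q s (e + 1) (r - 1) \<in> carrier_mat (r * q) (r * q)"
    using r by (simp add: hankel_def block_mat_def)
  have entry: "hankel q s (e + 1) (r - 1) $$ (i * q + b, l * q + b') = s (i + l + e) $$ (b, b')"
    if "l < r" "b' < q" for l b'
    using r e i bc that by (cases e) (simp_all add: hankel_def block_mat_def block_index_less)
  show ?thesis
    using bc i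
    by (subst mult_mat_entry[OF H block_col_carrier])
      (auto simp: sum_over_blocks block_index_less entry[simplified] mult_mat_entry[OF s X]
        simp del: index_mult_mat(1) intro!: sum.cong)
qed

lemma adjoint_block_col_mult:
  assumes X: "\<And>l. l < r \<Longrightarrow> X l \<in> carrier_mat q q" and Z: "\<And>l. l < r \<Longrightarrow> Z l \<in> carrier_mat q q"
    and ac: "a < q" "c < q"
  shows "(mat_adjoint (block_col q r X) * block_col q r Z) $$ (a, c) =
    (\<Sum>l<r. (mat_adjoint (X l) * Z l) $$ (a, c))"
proof -
  have "(mat_adjoint (X l) * Z l) $$ (a, c) = (\<Sum>b<q. cnj (X l $$ (b, a)) * Z l $$ (b, c))"
    if "l < r" for l
    using X[OF that] ac by (subst mult_mat_entry[OF mat_adjoint_carrier[OF X] Z]) (use that in auto)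
  then show ?thesis
    using ac
    by (subst mult_mat_entry[OF mat_adjoint_carrier[OF block_col_carrier] block_col_carrier])
      (auto simp: sum_over_blocks block_index_less simp del: index_mult_mat(1) intro!: sum.cong)
qed

lemma T_mat_carrier [simp]: "T_mat q m \<in> carrier_mat ((m + 1) * q) ((m + 1) * q)"
  unfolding T_mat_def by (auto simp: algebra_simps)

text \<open>$T_m$ shifts a block column down by one block: it has ones exactly at the positions
  $(j + q, j)$.\<close>

lemma T_mat_mult_block_col:
  "T_mat q m * block_col q (m + 1) X =
    block_col q (m + 1) (\<lambda>l. if l = 0 then 0\<^sub>m q q else X (l - 1))"
proof (rule block_col_eqI)
  fix l b c assume lbc: "l < m + 1" "b < q" "c < q"
  have T: "T_mat q m $$ (i, j) = (if i = j + q then 1 else 0)"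
    if "i < (m + 1) * q" "j < (m + 1) * q" for i j
    using that by (auto simp: T_mat_def)
  have i: "l * q + b < (m + 1) * q" using lbc by (intro block_index_less)
  have "(T_mat q m * block_col q (m + 1) X) $$ (l * q + b, c) =
      (\<Sum>j<(m + 1) * q. if l * q + b = j + q then block_col q (m + 1) X $$ (j, c) else 0)"
    using i lbc(3) by (subst mult_mat_entry[OF T_mat_carrier block_col_carrier])
      (auto simp: T simp del: index_mult_mat(1) intro!: sum.cong)
  also have "\<dots> = (if l = 0 then 0 else X (l - 1) $$ (b, c))"
  proof (cases l)
    case 0
    then show ?thesis using lbc by (auto intro!: sum.neutral)
  next
    case (Suc k)
    have eq: "l * q + b = j + q \<longleftrightarrow> j = k * q + b" for j using Suc by auto
    have "k * q + b < (m + 1) * q" using lbc Suc by (intro block_index_less) auto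
    then show ?thesis unfolding eq using Suc lbc by (simp add: sum.delta)
  qed
  finally show "(T_mat q m * block_col q (m + 1) X) $$ (l * q + b, c) =
      (if l = 0 then 0\<^sub>m q q else X (l - 1)) $$ (b, c)" using lbc by simp
qed (rule mult_carrier_mat[OF T_mat_carrier block_col_carrier])

lemma T_mat_pow_mult_block_col:
  "T_mat q m ^\<^sub>m k * block_col q (m + 1) X =
    block_col q (m + 1) (\<lambda>l. if l < k then 0\<^sub>m q q else X (l - k))"
proof (induction k arbitrary: X)
  case 0
  then show ?case using T_mat_carrier[of q m] by simp
next
  case (Suc k)
  have "T_mat q m ^\<^sub>m Suc k * block_col q (m + 1) X =
      T_mat q m ^\<^sub>m k * (T_mat q m * block_col q (m + 1) X)"
    using assoc_mult_mat[OF pow_carrier_mat[OF T_mat_carrier] T_mat_carrier block_col_carrier] by simp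
  also have "\<dots> = block_col q (m + 1) (\<lambda>l. if l < Suc k then 0\<^sub>m q q else X (l - Suc k))"
    unfolding T_mat_mult_block_col Suc.IH
    by (intro arg_cong[where f = "block_col q (m + 1)"] ext) auto
  finally show ?case .
qed

text \<open>By adjunction the shift is moved onto the first block column, where it leaves the first $k$
  blocks zero; the surviving terms pair the block $l$ of one column with the block $l + k$ of the
  other.\<close>

lemma shifted_block_col_pairing:
  assumes X: "\<And>l. l \<le> m \<Longrightarrow> X l \<in> carrier_mat q q" and Z: "\<And>l. l \<le> m \<Longrightarrow> Z l \<in> carrier_mat q q"
    and k: "k \<le> m" and ac: "a < q" "c < q"
  shows "(mat_adjoint (block_col q (m + 1) X) * mat_adjoint (T_mat q m ^\<^sub>m k) * block_col q (m + 1) Z) $$ (a, c) =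
    (\<Sum>l\<le>m - k. (mat_adjoint (X l) * Z (l + k)) $$ (a, c))"
proof -
  have "mat_adjoint (block_col q (m + 1) X) * mat_adjoint (T_mat q m ^\<^sub>m k) =
      mat_adjoint (block_col q (m + 1) (\<lambda>l. if l < k then 0\<^sub>m q q else X (l - k)))"
    by (simp only: T_mat_pow_mult_block_col
        flip: mat_adjoint_mult[OF pow_carrier_mat[OF T_mat_carrier] block_col_carrier])
  then have "(mat_adjoint (block_col q (m + 1) X) * mat_adjoint (T_mat q m ^\<^sub>m k) * block_col q (m + 1) Z) $$ (a, c) =
      (\<Sum>l<m + 1. (mat_adjoint (if l < k then 0\<^sub>m q q else X (l - k)) * Z l) $$ (a, c))"
    using X Z ac by (simp add: adjoint_block_col_mult del: index_mult_mat(1))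
  also have "\<dots> = (\<Sum>l\<in>{k..m}. (mat_adjoint (X (l - k)) * Z l) $$ (a, c))"
  proof (rule sum.mono_neutral_cong_right)
    show "\<forall>l\<in>{..<m + 1} - {k..m}. (mat_adjoint (if l < k then 0\<^sub>m q q else X (l - k)) * Z l) $$ (a, c) = 0"
    proof
      fix l assume "l \<in> {..<m + 1} - {k..m}"
      then have "l < k" "l \<le> m" by auto
      then show "(mat_adjoint (if l < k then 0\<^sub>m q q else X (l - k)) * Z l) $$ (a, c) = 0"
        using left_mult_zero_mat[OF Z[of l]] ac by (simp del: index_mult_mat(1))
    qed
  qed auto
  also have "\<dots> = (\<Sum>l\<le>m - k. (mat_adjoint (X l) * Z (l + k)) $$ (a, c))"
    by (rule sum.reindex_bij_witness[of _ "\<lambda>l. l + k" "\<lambda>l. l - k"]) (use k in auto)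
  finally show ?thesis .
qed

section \<open>The given matrices as block columns\<close>

lemma v_mat_block_col: "v_mat q m = block_col q (m + 1) (\<lambda>l. if l = 0 then 1\<^sub>m q else 0\<^sub>m q q)"
proof (rule block_col_eqI)
  fix l b c assume lbc: "l < m + 1" "b < q" "c < q"
  then have "l * q + b < (m + 1) * q" by (intro block_index_less)
  then show "v_mat q m $$ (l * q + b, c) = (if l = 0 then 1\<^sub>m q else 0\<^sub>m q q) $$ (b, c)"
    using lbc by (cases l) (auto simp: v_mat_def append_rows_def)
qed (auto simp: v_mat_def append_rows_def)

lemma y_col_block_col:
  assumes s: "\<And>j. s j \<in> carrier_mat q q"
  shows "y_col q s j k = block_col q (k + 1 - j) (\<lambda>l. mat_adjoint (s (j + l)))"
proof (rule block_col_eqI)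
  fix l b c assume lbc: "l < k + 1 - j" "b < q" "c < q"
  then show "y_col q s j k $$ (l * q + b, c) = mat_adjoint (s (j + l)) $$ (b, c)"
    using s[of "j + l"] block_index_less[OF lbc(1,2)] by (simp add: y_col_def block_mat_def)
qed (auto simp: y_col_def block_mat_def)

lemma u1_mat_block_col:
  assumes s: "\<And>j. s j \<in> carrier_mat q q" and m: "m \<ge> 1"
  shows "u_mat q s 1 m = block_col q (m + 1) (\<lambda>l. if l = 0 then 0\<^sub>m q q else - mat_adjoint (s (l - 1)))"
proof (rule block_col_eqI)
  fix l b c assume lbc: "l < m + 1" "b < q" "c < q"
  then have i: "l * q + b < (m + 1) * q" by (intro block_index_less)
  show "u_mat q s 1 m $$ (l * q + b, c) =
      (if l = 0 then 0\<^sub>m q q else - mat_adjoint (s (l - 1))) $$ (b, c)"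
  proof (cases l)
    case 0
    then show ?thesis using lbc m by (simp add: u_mat_def y_col_block_col[OF s] append_rows_def)
  next
    case (Suc k)
    then have "k * q + b < m * q" using lbc by (intro block_index_less) auto
    then show ?thesis using lbc m Suc i s[of k]
      by (simp add: u_mat_def y_col_block_col[OF s] append_rows_def)
  qed
qed (use m in \<open>auto simp: u_mat_def y_col_block_col[OF s] append_rows_def\<close>)

lemma u2_mat_block_col:
  assumes s: "\<And>j. s j \<in> carrier_mat q q"
  shows "u_mat q s 2 m = block_col q (m + 1) (\<lambda>l. - mat_adjoint (s l))"
proof (rule block_col_eqI)
  fix l b c assume lbc: "l < m + 1" "b < q" "c < q"
  then show "u_mat q s 2 m $$ (l * q + b, c) = (- mat_adjoint (s l)) $$ (b, c)"
    using s[of l] block_index_less[OF lbc(1,2)] by (simp add: u_mat_def y_col_block_col[OF s])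
qed (auto simp: u_mat_def y_col_block_col[OF s])


section \<open>Consequences of positivity\<close>

lemma hermitian_pos_def_minv:
  assumes H: "hermitian_pos_def k H"
  shows "H \<in> carrier_mat k k" "H * minv H = 1\<^sub>m k" "minv H * H = 1\<^sub>m k"
    "minv H \<in> carrier_mat k k" "mat_adjoint (minv H) = minv H"
proof -
  show c: "H \<in> carrier_mat k k" using H by (simp add: hermitian_pos_def_def)
  have adj: "mat_adjoint H = H" using H by (simp add: hermitian_pos_def_def)
  have "det H \<noteq> 0"
  proof
    assume "det H = 0"
    then obtain x where x: "x \<in> carrier_vec k" "x \<noteq> 0\<^sub>v k" "H *\<^sub>v x = 0\<^sub>v k"
      using det_0_iff_vec_prod_zero_field[OF c] by blast
    have "0 < (H *\<^sub>v x) \<bullet>c x" using H x(1,2) unfolding hermitian_pos_def_def by blast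
    moreover have "(H *\<^sub>v x) \<bullet>c x = 0"
      unfolding x(3) using x(1) by (intro scalar_prod_left_zero carrier_vec_conjugate)
    ultimately show False by simp
  qed
  note inv = minv_inverts[OF c this]
  then show "H * minv H = 1\<^sub>m k" "minv H * H = 1\<^sub>m k" "minv H \<in> carrier_mat k k" by auto
  let ?J = "mat_adjoint (minv H)"
  have J: "?J \<in> carrier_mat k k" using inv by simp
  have "?J * H = 1\<^sub>m k"
    using arg_cong[OF inv(1), of mat_adjoint] by (simp add: mat_adjoint_mult[OF c inv(3)] adj)
  then have "?J * H * minv H = minv H" using inv by simp
  then show "?J = minv H" using assoc_mult_mat[OF J c inv(3)] inv J by simp
qed

lemma stieltjes_positive_hankel:
  assumes pos: "stieltjes_positive q s \<kappa>" and r: "r \<ge> 1" "2 * (r - 1) + e \<le> \<kappa>" and e: "e \<le> 1"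
  shows "hermitian_pos_def (r * q) (hankel q s (e + 1) (r - 1))"
proof -
  have "hermitian_pos_def ((r - 1 + 1) * q) (hankel q s (e + 1) (r - 1))"
  proof (cases "e = 0")
    case True
    then have "hankel q s (e + 1) (r - 1) = hankel q s 1 (r - 1)" by simp
    then show ?thesis using pos r True unfolding stieltjes_positive_def by (metis add.right_neutral)
  next
    case False
    then have e1: "e = 1" using e by simp
    then have "hankel q s (e + 1) (r - 1) = hankel q s 2 (r - 1)" by (simp add: numeral_2_eq_2)
    then show ?thesis using pos r e1 unfolding stieltjes_positive_def by metis
  qed
  then show ?thesis using r by simp
qed

text \<open>A Hermitian block Hankel matrix has Hermitian diagonal blocks: $s_{2i}$ is the last diagonal
  block of $H_{1,i}$, and $s_{2i+1}$ that of $H_{2,i}$.\<close>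

lemma stieltjes_positive_hermitian:
  assumes pos: "stieltjes_positive q s \<kappa>" and s: "\<And>j. s j \<in> carrier_mat q q" and j: "j \<le> \<kappa>"
  shows "mat_adjoint (s j) = s j"
proof -
  define i e where "i = j div 2" and "e = j mod 2"
  have j': "j = i + i + e" and e: "e \<le> 1" unfolding i_def e_def by presburger+
  have "hermitian_pos_def ((i + 1) * q) (hankel q s (e + 1) i)"
    using stieltjes_positive_hankel[OF pos, of "i + 1" e] j j' e by simp
  then have adj: "mat_adjoint (hankel q s (e + 1) i) = hankel q s (e + 1) i"
    by (simp add: hermitian_pos_def_def)
  have dim: "dim_row (hankel q s (e + 1) i) = (i + 1) * q" "dim_col (hankel q s (e + 1) i) = (i + 1) * q"
    by (simp_all add: hankel_def block_mat_def)
  have entry: "hankel q s (e + 1) i $$ (i * q + a, i * q + b) = s j $$ (a, b)"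
    if "a < q" "b < q" for a b
    using that e j' block_index_less[of i "i + 1" _ q]
    by (cases e) (simp_all add: hankel_def block_mat_def)
  show ?thesis
  proof (rule eq_matI)
    fix a b assume "a < dim_row (s j)" "b < dim_col (s j)"
    then have ab: "a < q" "b < q" using s[of j] by auto
    then have "mat_adjoint (s j) $$ (a, b) = cnj (hankel q s (e + 1) i $$ (i * q + b, i * q + a))"
      using s[of j] by (simp add: entry del: One_nat_def add_Suc_right)
    also have "\<dots> = mat_adjoint (hankel q s (e + 1) i) $$ (i * q + a, i * q + b)"
      using ab dim block_index_less[of i "i + 1" _ q] by simp
    also have "\<dots> = s j $$ (a, b)" unfolding adj using ab by (rule entry)
    finally show "mat_adjoint (s j) $$ (a, b) = s j $$ (a, b)" .
  qed (use s[of j] in auto)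
qed

section \<open>The values of the matrix polynomials at zero\<close>

lemma R_mat_zero: "R_mat q m 0 = 1\<^sub>m ((m + 1) * q)"
proof -
  have "1\<^sub>m ((m + 1) * q) - 0 \<cdot>\<^sub>m T_mat q m = (1\<^sub>m ((m + 1) * q) :: complex mat)"
    using T_mat_carrier[of q m] by (intro eq_matI) auto
  then show ?thesis
    using minv_inverts(2,3)[of "1\<^sub>m ((m + 1) * q) :: complex mat" "(m + 1) * q"]
    by (simp add: R_mat_def)
qed

text \<open>The left factor of $P$ and $Q$ is the adjoint of $\Sigma$, because the inverse of a Hermitian
  matrix is Hermitian.\<close>

lemma adjoint_Sigma_mat:
  assumes "hermitian_pos_def (m * q) (hankel q s r (m - 1))" "Y_mat q s r m \<in> carrier_mat (m * q) q"
  shows "append_cols (- (mat_adjoint (Y_mat q s r m) * minv (hankel q s r (m - 1)))) (1\<^sub>m q) =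
    mat_adjoint (Sigma_mat q s r m)"
    and "Sigma_mat q s r m \<in> carrier_mat ((m + 1) * q) q"
proof -
  define J where "J = minv (hankel q s r (m - 1))"
  define Y where "Y = Y_mat q s r m"
  have J: "J \<in> carrier_mat (m * q) (m * q)" "mat_adjoint J = J"
    using hermitian_pos_def_minv[OF assms(1)] by (simp_all add: J_def)
  have Y: "Y \<in> carrier_mat (m * q) q" using assms by (simp add: Y_def)
  have JY: "J * Y \<in> carrier_mat (m * q) q" using J Y by simp
  have YJ: "mat_adjoint Y * J = mat_adjoint (J * Y)" using J Y by (simp add: mat_adjoint_mult)
  have "append_cols (- (mat_adjoint Y * J)) (1\<^sub>m q) = mat_adjoint (- (J * Y) @\<^sub>r 1\<^sub>m q)"
    unfolding YJ using JY by (intro eq_matI) (auto simp: append_cols_def append_rows_def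
      simp del: index_mult_mat(1))
  then show "append_cols (- (mat_adjoint (Y_mat q s r m) * minv (hankel q s r (m - 1)))) (1\<^sub>m q) =
    mat_adjoint (Sigma_mat q s r m)"
    by (simp add: Sigma_mat_def J_def Y_def)
  show "Sigma_mat q s r m \<in> carrier_mat ((m + 1) * q) q"
    using carrier_append_rows[OF uminus_carrier_iff_mat[THEN iffD2, OF JY] one_carrier_mat[of q]]
    by (simp add: Sigma_mat_def J_def Y_def add.commute)
qed

section \<open>The recurrence for the Markov parameters\<close>

lemma peval_matpoly_entry:
  assumes "z \<noteq> 0" "a < q" "b < q"
  shows "peval (matpoly q d C) z $$ (a, b) = z ^ d * (\<Sum>k\<le>d. C k $$ (a, b) * inverse z ^ k)"
proof -
  have "z ^ (d - k) = z ^ d * inverse z ^ k" if "k \<le> d" for k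
    using that assms by (simp add: power_diff power_inverse divide_inverse)
  then show ?thesis
    using assms by (simp add: peval_def matpoly_def poly_sum poly_monom sum_distrib_left mult_ac)
qed

lemma peval_matpoly_carrier [simp]: "peval (matpoly q d C) z \<in> carrier_mat q q"
  by (simp add: peval_def matpoly_def)

text \<open>The polynomial is written in $w = 1/z$, so that \<open>B 0\<close>, the leading coefficient in $z$, is its
  value at 0.  The determinant is continuous in $w$ and equals 1 there.\<close>

lemma det_monic_eventually_nonzero:
  fixes B :: "nat \<Rightarrow> complex mat"
  assumes B0: "B 0 = 1\<^sub>m q"
  shows "\<forall>\<^sub>F w in at 0. det (mat q q (\<lambda>(a, b). \<Sum>k\<le>m. B k $$ (a, b) * w ^ k)) \<noteq> 0"
proof -
  define M where "M w = mat q q (\<lambda>(a, b). \<Sum>k\<le>m. B k $$ (a, b) * w ^ k)" for w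
  have det: "det (M w) = (\<Sum>p | p permutes {0..<q}.
      signof p * (\<Prod>i = 0..<q. \<Sum>k\<le>m. B k $$ (i, p i) * w ^ k))" for w
    by (subst det_def'[of _ q])
      (auto simp: M_def permutes_in_image intro!: sum.cong prod.cong)
  have "isCont (\<lambda>w. det (M w)) 0"
    unfolding det by (intro continuous_intros)
  moreover have "M 0 = 1\<^sub>m q"
  proof -
    have "(\<Sum>k\<le>m. B k $$ ab * 0 ^ k) = B 0 $$ ab" for ab
      by (subst sum.remove[of _ 0]) (auto intro!: sum.neutral)
    then show ?thesis by (intro eq_matI) (auto simp: M_def B0)
  qed
  ultimately have "((\<lambda>w. det (M w)) \<longlongrightarrow> 1) (at 0)"
    by (simp add: isCont_def)
  then show ?thesis unfolding M_def by (rule tendsto_imp_eventually_ne) simp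
qed

text \<open>With $w = 1/z$ the numerator $N$ is $z^d$ times the polynomial in $w$ with coefficients
  \<open>C\<close>, and the denominator $D$ is $z^{d+1}$ times the one with coefficients \<open>B\<close>.  The degree $m$ in $w$
  is kept apart from $d$ in order to cover both parities: it is $d + 1$ in the even case, and $d$ in
  the odd case, where the denominator is $z$ times a polynomial of degree $d$ in $z$.
  Multiplying the expansion of $N D^{-1}$ by $D$ and comparing coefficients of $w^p$ gives the
  recurrence.\<close>

lemma laurent_quotient_recurrence:
  fixes B C s :: "nat \<Rightarrow> complex mat" and N D :: "complex \<Rightarrow> complex mat"
  assumes s: "\<And>j. s j \<in> carrier_mat q q"
    and B0: "B 0 = 1\<^sub>m q" and B: "\<And>k. k \<le> m \<Longrightarrow> B k \<in> carrier_mat q q"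
    and N: "\<And>z. N z \<in> carrier_mat q q" and D: "\<And>z. D z \<in> carrier_mat q q"
    and D_entry: "\<And>z a b. z \<noteq> 0 \<Longrightarrow> a < q \<Longrightarrow> b < q \<Longrightarrow>
      D z $$ (a, b) = z ^ Suc d * (\<Sum>k\<le>m. B k $$ (a, b) * inverse z ^ k)"
    and N_entry: "\<And>z a b. z \<noteq> 0 \<Longrightarrow> a < q \<Longrightarrow> b < q \<Longrightarrow>
      N z $$ (a, b) = z ^ d * (\<Sum>k\<le>d. C k $$ (a, b) * inverse z ^ k)"
    and expansion: "\<forall>\<^sub>F z in at_infinity. \<forall>a<q. \<forall>b<q.
      (\<lambda>j. (-1) ^ j * s j $$ (a, b) / z ^ (j + 1)) sums ((N z * minv (D z)) $$ (a, b))"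
    and ac: "a < q" "c < q"
  shows "(\<Sum>k\<le>min p m. (-1) ^ (p - k) * (s (p - k) * B k) $$ (a, c)) =
    (if p \<le> d then C p $$ (a, c) else 0)"
proof -
  define M where "M w = mat q q (\<lambda>(a, b). \<Sum>k\<le>m. B k $$ (a, b) * w ^ k)" for w
  have "\<forall>\<^sub>F w in at 0. \<forall>a<q. \<forall>b<q. (\<lambda>j. (-1) ^ j * s j $$ (a, b) / inverse w ^ (j + 1))
      sums ((N (inverse w) * minv (D (inverse w))) $$ (a, b))"
    using expansion filterlim_inverse_at_infinity unfolding filterlim_iff by fast
  moreover have "\<forall>\<^sub>F w in at 0. det (M w) \<noteq> 0"
    unfolding M_def using B0 by (rule det_monic_eventually_nonzero)
  ultimately have "\<forall>\<^sub>F w in at 0. det (M w) \<noteq> 0 \<and>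
      (\<forall>a<q. \<forall>b<q. (\<lambda>j. (-1) ^ j * s j $$ (a, b) / inverse w ^ (j + 1))
        sums ((N (inverse w) * minv (D (inverse w))) $$ (a, b)))"
    by eventually_elim simp
  then obtain r where r: "r > 0" and near: "\<And>w. w \<noteq> 0 \<Longrightarrow> norm w < r \<Longrightarrow> det (M w) \<noteq> 0 \<and>
      (\<forall>a<q. \<forall>b<q. (\<lambda>j. (-1) ^ j * s j $$ (a, b) / inverse w ^ (j + 1))
        sums ((N (inverse w) * minv (D (inverse w))) $$ (a, b)))"
    unfolding eventually_at by (auto simp: dist_norm)
  (* alpha is the coefficient sequence of expansion times denominator, beta that of the numerator *)
  define f where "f w = (\<Sum>k\<le>d. C k $$ (a, c) * w ^ k)" for w
  define \<alpha> where "\<alpha> p = (\<Sum>k\<le>m. if k \<le> p then (-1) ^ (p - k) * (s (p - k) * B k) $$ (a, c) else 0)" for p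
  define \<beta> where "\<beta> p = (if p \<le> d then C p $$ (a, c) else 0)" for p
  have "\<alpha> p = \<beta> p"
  proof (rule power_series_coeff_unique[OF r, where f = f])
    fix w :: complex assume w: "w \<noteq> 0" "norm w < r"
    have "(\<lambda>n. if n \<in> {..d} then C n $$ (a, c) * w ^ n else 0) sums f w"
      unfolding f_def by (rule sums_If_finite_set) simp
    moreover have "(\<lambda>n. if n \<in> {..d} then C n $$ (a, c) * w ^ n else 0) = (\<lambda>n. \<beta> n * w ^ n)"
      by (auto simp: \<beta>_def)
    ultimately show "(\<lambda>n. \<beta> n * w ^ n) sums f w" by simp
    define z where "z = inverse w"
    have z: "z \<noteq> 0" "inverse z = w" using w by (auto simp: z_def)
    define G where "G = N z * minv (D z)"
    have "D z = z ^ Suc d \<cdot>\<^sub>m M w"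
      using D[of z] by (intro eq_matI) (auto simp: D_entry[OF z(1)] M_def z)
    then have detD: "det (D z) \<noteq> 0" using near[OF w] z by simp
    note inv = minv_inverts[OF D detD]
    have G: "G \<in> carrier_mat q q" unfolding G_def using N[of z] inv(3) by simp
    have GD: "G * D z = N z"
      unfolding G_def using assoc_mult_mat[OF N[of z] inv(3) D[of z]] inv(2) right_mult_one_mat[OF N[of z]]
      by simp
    have series: "(\<lambda>j. (-1) ^ j * s j $$ (a, b) * w ^ j) sums (z * G $$ (a, b))" if "b < q" for b
    proof -
      have "(\<lambda>j. (-1) ^ j * s j $$ (a, b) / z ^ (j + 1)) sums G $$ (a, b)"
        using near[OF w] ac that by (simp add: G_def z_def)
      from sums_mult[OF this, of z] show ?thesis
        using z by (simp add: field_simps flip: z(2))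
    qed
    have shifted: "(\<lambda>n. (if k \<le> n then (-1) ^ (n - k) * s (n - k) $$ (a, b) else 0) * w ^ n)
        sums (z * G $$ (a, b) * w ^ k)" if "b < q" for b k
    proof -
      have "(\<lambda>n. (-1) ^ n * s n $$ (a, b) * w ^ n * w ^ k) sums (z * G $$ (a, b) * w ^ k)"
        by (intro sums_mult2 series that)
      then show ?thesis
        by (subst sums_iff_shift'[of _ k, symmetric]) (simp_all add: power_add mult.assoc sums_iff_shift)
    qed
    have "(\<lambda>n. \<Sum>b<q. \<Sum>k\<le>m. (if k \<le> n then (-1) ^ (n - k) * s (n - k) $$ (a, b) else 0) * w ^ n
        * B k $$ (b, c)) sums (\<Sum>b<q. \<Sum>k\<le>m. z * G $$ (a, b) * w ^ k * B k $$ (b, c))"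
      by (intro sums_sum sums_mult2 shifted) auto
    moreover have "(\<Sum>b<q. \<Sum>k\<le>m. (if k \<le> n then (-1) ^ (n - k) * s (n - k) $$ (a, b) else 0) * w ^ n
        * B k $$ (b, c)) = \<alpha> n * w ^ n" for n
      unfolding \<alpha>_def sum_distrib_right
      apply (subst sum.swap)
      by (intro sum.cong refl)
        (auto simp: mult_mat_entry[OF s B] ac sum_distrib_left sum_distrib_right mult_ac)
    moreover have "(\<Sum>b<q. \<Sum>k\<le>m. z * G $$ (a, b) * w ^ k * B k $$ (b, c)) = f w"
    proof -
      have "z ^ d * (\<Sum>b<q. \<Sum>k\<le>m. z * G $$ (a, b) * w ^ k * B k $$ (b, c)) =
          (\<Sum>b<q. G $$ (a, b) * D z $$ (b, c))"
        by (simp add: D_entry[OF z(1)] ac z sum_distrib_left mult_ac)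
      also have "\<dots> = N z $$ (a, c)"
        using mult_mat_entry[OF G D ac, of z] by (simp add: GD)
      also have "\<dots> = z ^ d * f w"
        by (simp add: N_entry[OF z(1) ac] z f_def)
      finally show ?thesis using z by simp
    qed
    ultimately show "(\<lambda>n. \<alpha> n * w ^ n) sums f w" by simp
  qed
  moreover have "\<alpha> p = (\<Sum>k\<le>min p m. (-1) ^ (p - k) * (s (p - k) * B k) $$ (a, c))"
    unfolding \<alpha>_def by (rule sum.mono_neutral_cong_right) auto
  ultimately show ?thesis by (simp add: \<beta>_def)
qed


text \<open>The two parities differ only in \<open>e\<close>, which is also the offset in the blocks $s_{a+b+e}$ of the
  Hankel matrix: degree $n = 2m + e$ goes with the matrices of index $r = e + 1$.\<close>

locale stieltjes_markov =
  fixes q m n e :: nat and A s :: "nat \<Rightarrow> complex mat"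
  assumes m: "m \<ge> 1" and n: "n = 2 * m + e" "e \<le> 1"
    and A0: "A 0 = 1\<^sub>m q" and A: "j \<le> n \<Longrightarrow> A j \<in> carrier_mat q q"
    and mp: "markov_parameters q n A s" and pos: "stieltjes_positive q s (n - 1)"
begin

lemma s_carrier: "s j \<in> carrier_mat q q"
  using mp by (simp add: markov_parameters_def)

lemma markov_recurrence:
  assumes ac: "a < q" "c < q"
  shows "(\<Sum>k\<le>min p m. (-1) ^ (p - k) * (s (p - k) * A (2 * k)) $$ (a, c)) =
    (if 2 * p + 1 \<le> n then A (2 * p + 1) $$ (a, c) else 0)"
proof -
  have expansion: "\<forall>\<^sub>F z in at_infinity. \<forall>a<q. \<forall>b<q.
      (\<lambda>j. (-1) ^ j * s j $$ (a, b) / z ^ (j + 1)) sums (markov_function q n A z $$ (a, b))"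
    using mp by (simp_all add: markov_parameters_def)
  consider "e = 0" | "e = 1" using n by linarith
  then show ?thesis
  proof cases
    case 1
    then have n0: "n = 2 * m" using n by simp
    have rec: "(\<Sum>k\<le>min p m. (-1) ^ (p - k) * (s (p - k) * A (2 * k)) $$ (a, c)) =
        (if p \<le> m - 1 then A (2 * p + 1) $$ (a, c) else 0)"
    proof (rule laurent_quotient_recurrence[where B = "\<lambda>k. A (2 * k)" and C = "\<lambda>k. A (2 * k + 1)"
          and N = "peval (matpoly q (m - 1) (\<lambda>k. A (2 * k + 1)))"
          and D = "peval (matpoly q m (\<lambda>k. A (2 * k)))"])
      show "\<forall>\<^sub>F z in at_infinity. \<forall>a<q. \<forall>b<q. (\<lambda>j. (-1) ^ j * s j $$ (a, b) / z ^ (j + 1)) sums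
          ((peval (matpoly q (m - 1) (\<lambda>k. A (2 * k + 1))) z *
            minv (peval (matpoly q m (\<lambda>k. A (2 * k))) z)) $$ (a, b))"
        using expansion by (simp add: markov_function_def g_poly_def h_poly_def n0)
    qed (use m n0 A s_carrier ac A0 in \<open>simp_all add: peval_matpoly_entry\<close>)
    have "p \<le> m - 1 \<longleftrightarrow> 2 * p + 1 \<le> n" using m n0 by linarith
    with rec show ?thesis by (simp only:)
  next
    case 2
    then have n1: "n = 2 * m + 1" using n by simp
    have rec: "(\<Sum>k\<le>min p m. (-1) ^ (p - k) * (s (p - k) * A (2 * k)) $$ (a, c)) =
        (if p \<le> m then A (2 * p + 1) $$ (a, c) else 0)"
    proof (rule laurent_quotient_recurrence[where B = "\<lambda>k. A (2 * k)" and C = "\<lambda>k. A (2 * k + 1)"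
          and N = "peval (matpoly q m (\<lambda>k. A (2 * k + 1)))"
          and D = "\<lambda>z. z \<cdot>\<^sub>m peval (matpoly q m (\<lambda>k. A (2 * k))) z"])
      show "\<forall>\<^sub>F z in at_infinity. \<forall>a<q. \<forall>b<q. (\<lambda>j. (-1) ^ j * s j $$ (a, b) / z ^ (j + 1)) sums
          ((peval (matpoly q m (\<lambda>k. A (2 * k + 1))) z *
            minv (z \<cdot>\<^sub>m peval (matpoly q m (\<lambda>k. A (2 * k))) z)) $$ (a, b))"
        using expansion by (simp add: markov_function_def g_poly_def h_poly_def n1)
      show "(z \<cdot>\<^sub>m peval (matpoly q m (\<lambda>k. A (2 * k))) z) $$ (a, b) =
          z ^ Suc m * (\<Sum>k\<le>m. A (2 * k) $$ (a, b) * inverse z ^ k)"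
        if "z \<noteq> 0" "a < q" "b < q" for z a b
        using that carrier_matD[OF peval_matpoly_carrier[of q m "\<lambda>k. A (2 * k)" z]]
        by (simp add: peval_matpoly_entry)
    qed (use m n1 A s_carrier ac A0 in \<open>simp_all add: peval_matpoly_entry\<close>)
    have "p \<le> m \<longleftrightarrow> 2 * p + 1 \<le> n" using n1 by linarith
    with rec show ?thesis by (simp only:)
  qed
qed

text \<open>The rows of the recurrence with vanishing right-hand side are a Hankel system for the even
  coefficients, and $\Sigma$ is built from its solution.  The alternating signs of the recurrence
  are absorbed in the blocks.\<close>

lemma Sigma_mat_block_col:
  shows "Sigma_mat q s (e + 1) m = block_col q (m + 1) (\<lambda>l. (-1) ^ (m - l) \<cdot>\<^sub>m A (2 * (m - l)))"
proof -
  define Z where "Z l = (-1) ^ (m - l) \<cdot>\<^sub>m A (2 * (m - l))" for l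
  define H where "H = hankel q s (e + 1) (m - 1)"
  define W where "W = block_col q m Z"
  define Y where "Y = Y_mat q s (e + 1) m"
  have Z: "Z l \<in> carrier_mat q q" for l using A n by (simp add: Z_def)
  have "hermitian_pos_def (m * q) H"
    unfolding H_def using m n by (intro stieltjes_positive_hankel[OF pos]) auto
  note H = hermitian_pos_def_minv[OF this]
  have Y_block: "Y = block_col q m (\<lambda>i. mat_adjoint (s (m + e + i)))"
    using m n by (cases e) (simp_all add: Y_def Y_mat_def y_col_block_col[OF s_carrier])
  then have Y: "Y \<in> carrier_mat (m * q) q" by simp
  have W: "W \<in> carrier_mat (m * q) q" by (simp add: W_def)
  have "H * W = - Y"
  proof -
    have "H * W = block_col q m (\<lambda>i. - mat_adjoint (s (m + e + i)))"
    proof (rule block_col_eqI)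
      fix i b c assume ibc: "i < m" "b < q" "c < q"
      (* row i of the Hankel system is the coefficient of w^p; the exponent m + e of row 0 is the
         smallest p with 2 * p + 1 > n *)
      define p where "p = m + e + i"
      have AZ: "(s (i + l + e) * Z l) $$ (b, c) = (-1) ^ (m - l) * (s (i + l + e) * A (2 * (m - l))) $$ (b, c)" for l
      proof -
        have Al: "A (2 * (m - l)) \<in> carrier_mat q q" using A n by simp
        show ?thesis
          unfolding Z_def mult_smult_distrib[OF s_carrier Al]
          by (rule smult_mat_entry[OF mult_carrier_mat[OF s_carrier Al] ibc(2,3)])
      qed
      have "(-1) ^ p * (\<Sum>k\<le>m. (-1) ^ (p - k) * (s (p - k) * A (2 * k)) $$ (b, c)) = 0"
        using markov_recurrence[OF ibc(2,3), of p] n by (simp add: p_def)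
      also have "(-1) ^ p * (\<Sum>k\<le>m. (-1) ^ (p - k) * (s (p - k) * A (2 * k)) $$ (b, c)) =
          (\<Sum>k\<le>m. (-1) ^ k * (s (p - k) * A (2 * k)) $$ (b, c))"
      proof -
        have "(-1) ^ p * (-1) ^ (p - k) = ((-1) ^ k :: complex)" if "k \<le> m" for k
        proof -
          define d where "d = p - k"
          have "p = d + k" using that by (simp add: d_def p_def)
          then show ?thesis by (simp add: power_add mult_ac flip: power_mult_distrib)
        qed
        then show ?thesis by (simp add: sum_distrib_left flip: mult.assoc del: index_mult_mat(1))
      qed
      also have "\<dots> = (\<Sum>l\<le>m. (-1) ^ (m - l) * (s (i + l + e) * A (2 * (m - l))) $$ (b, c))"
        by (rule sum.reindex_bij_witness[of _ "\<lambda>k. m - k" "\<lambda>k. m - k"])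
          (auto simp: p_def add_ac simp del: index_mult_mat(1))
      also have "\<dots> = (\<Sum>l<m. (s (i + l + e) * Z l) $$ (b, c)) + s (m + e + i) $$ (b, c)"
        unfolding lessThan_Suc_atMost[symmetric] sum.lessThan_Suc AZ
        using right_mult_one_mat[OF s_carrier[of "m + e + i"]]
        by (simp add: A0 add_ac del: index_mult_mat(1))
      finally have "(\<Sum>l<m. (s (i + l + e) * Z l) $$ (b, c)) = - s (m + e + i) $$ (b, c)"
        by (simp add: eq_neg_iff_add_eq_0 del: index_mult_mat(1))
      moreover have "(H * W) $$ (i * q + b, c) = (\<Sum>l<m. (s (i + l + e) * Z l) $$ (b, c))"
        unfolding H_def W_def using m n ibc by (intro hankel_mult_block_col s_carrier Z) auto
      moreover have "mat_adjoint (s (m + e + i)) = s (m + e + i)"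
        using stieltjes_positive_hermitian[OF pos s_carrier] n ibc by simp
      ultimately show "(H * W) $$ (i * q + b, c) = (- mat_adjoint (s (m + e + i))) $$ (b, c)"
        using s_carrier[of "m + e + i"] ibc by (simp del: index_mult_mat(1))
    qed (rule mult_carrier_mat[OF H(1) W])
    also have "\<dots> = - Y"
    proof (rule block_col_eqI[symmetric])
      fix l b c assume "l < m" "b < q" "c < q"
      then show "(- Y) $$ (l * q + b, c) = (- mat_adjoint (s (m + e + l))) $$ (b, c)"
        using s_carrier[of "m + e + l"] block_index_less[of l m b q] by (simp add: Y_block)
    qed (use Y in simp)
    finally show ?thesis .
  qed
  then have "minv H * (H * W) = minv H * (- Y)" by simp
  then have "W = minv H * (- Y)"
    using assoc_mult_mat[OF H(4) H(1) W] H(3) W by simp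
  then have W_eq: "- (minv H * Y) = W" using H(4) Y by simp
  have "Sigma_mat q s (e + 1) m = W @\<^sub>r 1\<^sub>m q"
    unfolding Sigma_mat_def by (simp only: W_eq flip: H_def Y_def)
  also have "\<dots> = block_col q (m + 1) Z"
  proof (rule block_col_eqI)
    fix l b c assume lbc: "l < m + 1" "b < q" "c < q"
    show "(W @\<^sub>r 1\<^sub>m q) $$ (l * q + b, c) = Z l $$ (b, c)"
    proof (cases "l < m")
      case True
      then have "l * q + b < m * q" using lbc by (intro block_index_less)
      then show ?thesis using lbc True by (simp add: append_rows_def W_def)
    next
      case False
      then have "l = m" using lbc by simp
      then show ?thesis using lbc by (simp add: append_rows_def W_def Z_def A0)
    qed
  qed (auto simp: append_rows_def W_def)
  finally show ?thesis unfolding Z_def[abs_def] .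
qed


lemma Y_mat_carrier: "Y_mat q s (e + 1) m \<in> carrier_mat (m * q) q"
proof -
  have "Y_mat q s (e + 1) m = block_col q m (\<lambda>i. mat_adjoint (s (m + e + i)))"
    using m n by (cases e) (simp_all add: Y_mat_def y_col_block_col[OF s_carrier])
  then show ?thesis by simp
qed

lemma hankel_pos_def: "hermitian_pos_def (m * q) (hankel q s (e + 1) (m - 1))"
  using m n by (intro stieltjes_positive_hankel[OF pos]) auto

section \<open>The coefficients\<close>

lemma even_coefficient:
  assumes j: "j \<le> m"
  shows "A (2 * j) = (-1) ^ j \<cdot>\<^sub>m
    (mat_adjoint (v_mat q m) * mat_adjoint (T_mat q m ^\<^sub>m (m - j)) * Sigma_mat q s (e + 1) m)"
    (is "_ = _ \<cdot>\<^sub>m ?M")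
proof -
  define Z where "Z l = (-1) ^ (m - l) \<cdot>\<^sub>m A (2 * (m - l))" for l
  have Z: "Z l \<in> carrier_mat q q" for l using A n by (simp add: Z_def)
  have M: "?M \<in> carrier_mat q q"
    unfolding Sigma_mat_block_col v_mat_block_col
    by (rule mult_carrier_mat[OF mult_carrier_mat[OF mat_adjoint_carrier[OF block_col_carrier]
          mat_adjoint_carrier[OF pow_carrier_mat[OF T_mat_carrier]]] block_col_carrier])
  have Aj: "A (2 * j) \<in> carrier_mat q q" using A n j by simp
  show ?thesis
  proof (rule eq_matI)
    fix a c assume "a < dim_row ((-1) ^ j \<cdot>\<^sub>m ?M)" "c < dim_col ((-1) ^ j \<cdot>\<^sub>m ?M)"
    then have ac: "a < q" "c < q" using M by auto
    have "?M $$ (a, c) =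
        (\<Sum>l\<le>j. (mat_adjoint (if l = 0 then 1\<^sub>m q else 0\<^sub>m q q) * Z (l + (m - j))) $$ (a, c))"
      unfolding Sigma_mat_block_col v_mat_block_col Z_def[symmetric]
      using j by (subst shifted_block_col_pairing) (auto simp: Z ac simp del: index_mult_mat(1))
    also have "\<dots> = Z (m - j) $$ (a, c)"
      using left_mult_one_mat[OF Z] left_mult_zero_mat[OF Z] ac
      by (subst sum.remove[of _ 0]) (auto simp del: index_mult_mat(1) intro!: sum.neutral)
    finally have "?M $$ (a, c) = (-1) ^ j * A (2 * j) $$ (a, c)"
      using j ac A[of "2 * j"] n by (simp add: Z_def del: index_mult_mat(1))
    then show "A (2 * j) $$ (a, c) = ((-1) ^ j \<cdot>\<^sub>m ?M) $$ (a, c)"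
      unfolding smult_mat_entry[OF M ac]
      by (simp del: index_mult_mat(1) flip: mult.assoc power_mult_distrib)
  qed (use carrier_matD[OF M] carrier_matD[OF Aj] in \<open>simp_all only: index_smult_mat\<close>)
qed

text \<open>The rows of the recurrence whose right-hand side is an odd coefficient, summed in
  reverse order and with signs arranged as in the pairing of the blocks $-s_l^*$ of $u$ with those of $\Sigma$.\<close>

lemma odd_coefficient_sum:
  assumes j: "2 * j + 1 \<le> n" and ac: "a < q" "c < q"
  shows "A (2 * j + 1) $$ (a, c) = (-1) ^ (j + 1) *
    (\<Sum>l\<le>j. (mat_adjoint (- mat_adjoint (s l)) *
      ((-1) ^ (j - l) \<cdot>\<^sub>m A (2 * (j - l)))) $$ (a, c))"
proof -
  have jm: "j \<le> m" using j n by linarith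
  have summand: "(mat_adjoint (- mat_adjoint (s l)) * ((-1) ^ (j - l) \<cdot>\<^sub>m A (2 * (j - l)))) $$ (a, c) =
      - ((-1) ^ (j - l) * (s l * A (2 * (j - l))) $$ (a, c))" if "l \<le> j" for l
  proof -
    have Al: "A (2 * (j - l)) \<in> carrier_mat q q" using A j by simp
    have "mat_adjoint (- mat_adjoint (s l)) = - s l"
      using s_carrier[of l] by (intro eq_matI) auto
    then show ?thesis
      using ac s_carrier[of l] Al by (simp add: sum_negf scalar_prod_def sum_distrib_left mult_ac)
  qed
  have "A (2 * j + 1) $$ (a, c) = (\<Sum>k\<le>j. (-1) ^ (j - k) * (s (j - k) * A (2 * k)) $$ (a, c))"
    using markov_recurrence[OF ac, of j] j jm by simp
  also have "\<dots> = (\<Sum>l\<le>j. (-1) ^ l * (s l * A (2 * (j - l))) $$ (a, c))"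
    by (rule sum.reindex_bij_witness[of _ "\<lambda>k. j - k" "\<lambda>k. j - k"]) auto
  also have "\<dots> = (\<Sum>l\<le>j. (-1) ^ (j + 1) *
      (mat_adjoint (- mat_adjoint (s l)) * ((-1) ^ (j - l) \<cdot>\<^sub>m A (2 * (j - l)))) $$ (a, c))"
  proof (rule sum.cong)
    fix l assume "l \<in> {..j}"
    then have l: "l \<le> j" by simp
    define d where "d = j - l"
    have "j = l + d" using l by (simp add: d_def)
    then have sign: "(-1) ^ (j + 1) * (-1) ^ (j - l) = (- ((-1) ^ l) :: complex)"
      by (simp add: power_add mult.assoc flip: power_mult_distrib)
    then show "(-1) ^ l * (s l * A (2 * (j - l))) $$ (a, c) = (-1) ^ (j + 1) *
      (mat_adjoint (- mat_adjoint (s l)) * ((-1) ^ (j - l) \<cdot>\<^sub>m A (2 * (j - l)))) $$ (a, c)"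
      unfolding summand[OF l] mult_minus_right mult.assoc[symmetric] sign by simp
  qed simp
  finally show ?thesis by (simp only: sum_distrib_left)
qed

lemma odd_coefficient_odd_degree:
  assumes e: "e = 1" and j: "j \<le> m"
  shows "A (2 * j + 1) = (-1) ^ (j + 1) \<cdot>\<^sub>m
    (mat_adjoint (u_mat q s 2 m) * mat_adjoint (T_mat q m ^\<^sub>m (m - j)) * Sigma_mat q s (e + 1) m)"
    (is "_ = _ \<cdot>\<^sub>m ?M")
proof -
  have M: "?M \<in> carrier_mat q q"
    unfolding Sigma_mat_block_col u2_mat_block_col[OF s_carrier]
    by (rule mult_carrier_mat[OF mult_carrier_mat[OF mat_adjoint_carrier[OF block_col_carrier]
          mat_adjoint_carrier[OF pow_carrier_mat[OF T_mat_carrier]]] block_col_carrier])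
  have Aj: "A (2 * j + 1) \<in> carrier_mat q q" using A n e j by simp
  show ?thesis
  proof (rule eq_matI)
    fix a c assume "a < dim_row ((-1) ^ (j + 1) \<cdot>\<^sub>m ?M)" "c < dim_col ((-1) ^ (j + 1) \<cdot>\<^sub>m ?M)"
    then have ac: "a < q" "c < q" using M by auto
    have "?M $$ (a, c) = (\<Sum>l\<le>m - (m - j). (mat_adjoint (- mat_adjoint (s l)) *
        ((-1) ^ (m - (l + (m - j))) \<cdot>\<^sub>m A (2 * (m - (l + (m - j)))))) $$ (a, c))"
      unfolding Sigma_mat_block_col u2_mat_block_col[OF s_carrier]
      by (rule shifted_block_col_pairing) (use s_carrier A n ac in auto)
    also have "\<dots> = (\<Sum>l\<le>j. (mat_adjoint (- mat_adjoint (s l)) *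
        ((-1) ^ (j - l) \<cdot>\<^sub>m A (2 * (j - l)))) $$ (a, c))"
    proof (rule sum.cong)
      fix l assume "l \<in> {..j}"
      then have "m - (l + (m - j)) = j - l" using j by simp
      then show "(mat_adjoint (- mat_adjoint (s l)) *
        ((-1) ^ (m - (l + (m - j))) \<cdot>\<^sub>m A (2 * (m - (l + (m - j)))))) $$ (a, c) =
        (mat_adjoint (- mat_adjoint (s l)) * ((-1) ^ (j - l) \<cdot>\<^sub>m A (2 * (j - l)))) $$ (a, c)"
        by (simp only:)
    qed (use j in simp)
    finally show "A (2 * j + 1) $$ (a, c) = ((-1) ^ (j + 1) \<cdot>\<^sub>m ?M) $$ (a, c)"
      using ac j n e unfolding smult_mat_entry[OF M ac]
      by (subst odd_coefficient_sum) (simp_all del: index_mult_mat(1))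
  qed (use carrier_matD[OF M] carrier_matD[OF Aj] in \<open>simp_all only: index_smult_mat\<close>)
qed

text \<open>The leading zero block of $u_{1,m}$ is itself a shift by one, which accounts for the exponent
  $m - j - 1$ in place of $m - j$.\<close>

lemma odd_coefficient_even_degree:
  assumes e: "e = 0" and j: "j < m"
  shows "A (2 * j + 1) = (-1) ^ (j + 1) \<cdot>\<^sub>m
    (mat_adjoint (u_mat q s 1 m) * mat_adjoint (T_mat q m ^\<^sub>m (m - j - 1)) * Sigma_mat q s (e + 1) m)"
    (is "_ = _ \<cdot>\<^sub>m ?M")
proof -
  have M: "?M \<in> carrier_mat q q"
    unfolding Sigma_mat_block_col u1_mat_block_col[OF s_carrier m]
    by (rule mult_carrier_mat[OF mult_carrier_mat[OF mat_adjoint_carrier[OF block_col_carrier]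
          mat_adjoint_carrier[OF pow_carrier_mat[OF T_mat_carrier]]] block_col_carrier])
  have Aj: "A (2 * j + 1) \<in> carrier_mat q q" using A n e j by simp
  define Z where "Z l = (-1) ^ (m - l) \<cdot>\<^sub>m A (2 * (m - l))" for l
  have Z: "Z l \<in> carrier_mat q q" for l using A n by (simp add: Z_def)
  show ?thesis
  proof (rule eq_matI)
    fix a c assume "a < dim_row ((-1) ^ (j + 1) \<cdot>\<^sub>m ?M)" "c < dim_col ((-1) ^ (j + 1) \<cdot>\<^sub>m ?M)"
    then have ac: "a < q" "c < q" using M by auto
    have "?M $$ (a, c) = (\<Sum>l\<le>m - (m - j - 1).
        (mat_adjoint (if l = 0 then 0\<^sub>m q q else - mat_adjoint (s (l - 1))) * Z (l + (m - j - 1))) $$ (a, c))"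
      unfolding Sigma_mat_block_col u1_mat_block_col[OF s_carrier m] Z_def[symmetric]
      by (rule shifted_block_col_pairing) (use s_carrier Z ac in auto)
    also have "m - (m - j - 1) = Suc j" using j by simp
    also have "(\<Sum>l\<le>Suc j.
        (mat_adjoint (if l = 0 then 0\<^sub>m q q else - mat_adjoint (s (l - 1))) * Z (l + (m - j - 1))) $$ (a, c)) =
        (\<Sum>l\<le>j. (mat_adjoint (- mat_adjoint (s l)) * Z (Suc l + (m - j - 1))) $$ (a, c))"
      unfolding sum.atMost_Suc_shift using left_mult_zero_mat[OF Z] ac by (simp del: index_mult_mat(1))
    also have "\<dots> = (\<Sum>l\<le>j. (mat_adjoint (- mat_adjoint (s l)) *
        ((-1) ^ (j - l) \<cdot>\<^sub>m A (2 * (j - l)))) $$ (a, c))"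
    proof (rule sum.cong)
      fix l assume "l \<in> {..j}"
      then have "m - (Suc l + (m - j - 1)) = j - l" using j by simp
      then show "(mat_adjoint (- mat_adjoint (s l)) * Z (Suc l + (m - j - 1))) $$ (a, c) =
        (mat_adjoint (- mat_adjoint (s l)) * ((-1) ^ (j - l) \<cdot>\<^sub>m A (2 * (j - l)))) $$ (a, c)"
        by (simp only: Z_def)
    qed simp
    finally show "A (2 * j + 1) $$ (a, c) = ((-1) ^ (j + 1) \<cdot>\<^sub>m ?M) $$ (a, c)"
      using ac j n e unfolding smult_mat_entry[OF M ac]
      by (subst odd_coefficient_sum) (simp_all del: index_mult_mat(1))
  qed (use carrier_matD[OF M] carrier_matD[OF Aj] in \<open>simp_all only: index_smult_mat\<close>)
qed

lemma first_coefficient: "A 1 = s 0"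
proof (rule eq_matI)
  fix a c assume "a < dim_row (s 0)" "c < dim_col (s 0)"
  then have "a < q" "c < q" using s_carrier[of 0] by auto
  then show "A 1 $$ (a, c) = s 0 $$ (a, c)"
    using markov_recurrence[of a c 0] m n right_mult_one_mat[OF s_carrier[of 0]]
    by (simp add: A0 del: index_mult_mat(1))
qed (use s_carrier[of 0] A[of 1] m n in auto)

lemma adjoint_P_mat_zero:
  "mat_adjoint (P_mat q s (e + 1) m 0) = mat_adjoint (v_mat q m) * Sigma_mat q s (e + 1) m"
proof -
  note S = adjoint_Sigma_mat[OF hankel_pos_def Y_mat_carrier]
  have v: "v_mat q m \<in> carrier_mat ((m + 1) * q) q" unfolding v_mat_block_col by (rule block_col_carrier)
  have "P_mat q s (e + 1) m 0 = mat_adjoint (Sigma_mat q s (e + 1) m) * v_mat q m"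
    unfolding P_mat_def S(1) R_mat_zero right_mult_one_mat[OF mat_adjoint_carrier[OF S(2)]] ..
  then show ?thesis by (simp only: mat_adjoint_mult[OF mat_adjoint_carrier[OF S(2)] v] mat_adjoint_adjoint)
qed

lemma adjoint_Q_mat_zero:
  assumes u: "u_mat q s (e + 1) m \<in> carrier_mat ((m + 1) * q) q"
  shows "mat_adjoint (Q_mat q s (e + 1) m 0) =
    - (mat_adjoint (u_mat q s (e + 1) m) * Sigma_mat q s (e + 1) m)"
proof -
  note S = adjoint_Sigma_mat[OF hankel_pos_def Y_mat_carrier]
  have "Q_mat q s (e + 1) m 0 = - (mat_adjoint (Sigma_mat q s (e + 1) m) * u_mat q s (e + 1) m)"
    unfolding Q_mat_def S(1) R_mat_zero right_mult_one_mat[OF mat_adjoint_carrier[OF S(2)]] ..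
  moreover have "mat_adjoint (- M) = - mat_adjoint M" for M :: "complex mat"
    by (rule eq_matI) auto
  ultimately show ?thesis
    by (simp only: mat_adjoint_mult[OF mat_adjoint_carrier[OF S(2)] u] mat_adjoint_adjoint)
qed

end

section \<open>The representation of the coefficients\<close>

theorem lemma3p1:
  fixes q m n :: nat and A s :: "nat \<Rightarrow> complex mat"
  assumes "q \<ge> 1" and "m \<ge> 1" and "n = 2 * m \<or> n = 2 * m + 1"
    and "A 0 = 1\<^sub>m q" and "\<forall>j. 1 \<le> j \<and> j \<le> n \<longrightarrow> A j \<in> carrier_mat q q"
    and "htm_polynomial q n A"
    and "markov_parameters q n A s"
    and "stieltjes_positive q s (n - 1)"
  defines "T \<equiv> T_mat q m" and "v \<equiv> v_mat q m"
    and "u1 \<equiv> u_mat q s 1 m" and "u2 \<equiv> u_mat q s 2 m"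
    and "\<Sigma>1 \<equiv> Sigma_mat q s 1 m" and "\<Sigma>2 \<equiv> Sigma_mat q s 2 m"
    and "P \<equiv> \<lambda>k. P_mat q s k m" and "Q \<equiv> \<lambda>k. Q_mat q s k m"
  shows
    "(n = 2 * m \<longrightarrow>
       (\<forall>j\<le>m. A (2 * j) =
          (-1) ^ j \<cdot>\<^sub>m (mat_adjoint v * mat_adjoint (T ^\<^sub>m (m - j)) * \<Sigma>1)) \<and>
       (\<forall>j<m. A (2 * j + 1) =
          (-1) ^ (j + 1) \<cdot>\<^sub>m (mat_adjoint u1 * mat_adjoint (T ^\<^sub>m (m - j - 1)) * \<Sigma>1)) \<and>
       1\<^sub>m q = mat_adjoint v * mat_adjoint (T ^\<^sub>m m) * \<Sigma>1 \<and>
       A 1 = - (mat_adjoint u1 * mat_adjoint (T ^\<^sub>m (m - 1)) * \<Sigma>1) \<and>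
       A 1 = s 0 \<and>
       A (2 * m - 1) = (-1) ^ m \<cdot>\<^sub>m (mat_adjoint u1 * \<Sigma>1) \<and>
       A (2 * m - 1) = (-1) ^ (m + 1) \<cdot>\<^sub>m mat_adjoint (Q 1 0) \<and>
       A (2 * m) = (-1) ^ m \<cdot>\<^sub>m (mat_adjoint v * \<Sigma>1) \<and>
       A (2 * m) = (-1) ^ m \<cdot>\<^sub>m mat_adjoint (P 1 0)) \<and>
     (n = 2 * m + 1 \<longrightarrow>
       (\<forall>j\<le>m. A (2 * j) =
          (-1) ^ j \<cdot>\<^sub>m (mat_adjoint v * mat_adjoint (T ^\<^sub>m (m - j)) * \<Sigma>2)) \<and>
       (\<forall>j\<le>m. A (2 * j + 1) =
          (-1) ^ (j + 1) \<cdot>\<^sub>m (mat_adjoint u2 * mat_adjoint (T ^\<^sub>m (m - j)) * \<Sigma>2)) \<and>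
       1\<^sub>m q = mat_adjoint v * mat_adjoint (T ^\<^sub>m m) * \<Sigma>2 \<and>
       A 1 = - (mat_adjoint u2 * mat_adjoint (T ^\<^sub>m m) * \<Sigma>2) \<and>
       A 1 = s 0 \<and>
       A (2 * m) = (-1) ^ m \<cdot>\<^sub>m (mat_adjoint v * \<Sigma>2) \<and>
       A (2 * m) = (-1) ^ m \<cdot>\<^sub>m mat_adjoint (P 2 0) \<and>
       A (2 * m + 1) = (-1) ^ (m + 1) \<cdot>\<^sub>m (mat_adjoint u2 * \<Sigma>2) \<and>
       A (2 * m + 1) = (-1) ^ m \<cdot>\<^sub>m mat_adjoint (Q 2 0))"
proof (intro conjI[where Q = "_ \<longrightarrow> _"] impI)
  have A_carrier: "A j \<in> carrier_mat q q" if "j \<le> n" for j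
    using assms(4,5) that by (cases j) auto
  have T0: "mat_adjoint x * mat_adjoint (T ^\<^sub>m 0) * S = mat_adjoint x * S"
    if "x \<in> carrier_mat ((m + 1) * q) q" for x S :: "complex mat"
    using right_mult_one_mat[OF mat_adjoint_carrier[OF that]] carrier_matD[OF T_mat_carrier[of q m]]
    by (simp add: T_def)
  have v: "v \<in> carrier_mat ((m + 1) * q) q" unfolding v_def v_mat_block_col by (rule block_col_carrier)
  have neg_one: "(-1) \<cdot>\<^sub>m M = - M" for M :: "complex mat" by (rule eq_matI) auto
  have one: "1 \<cdot>\<^sub>m M = M" for M :: "complex mat" by (rule eq_matI) auto
  {
    assume n0: "n = 2 * m"
    interpret stieltjes_markov q m n 0 A s
      by unfold_locales (use assms(2,4,7,8) A_carrier n0 in auto)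
    have u: "u1 \<in> carrier_mat ((m + 1) * q) q"
      unfolding u1_def u1_mat_block_col[OF s_carrier m] by (rule block_col_carrier)
    have even: "A (2 * j) = (-1) ^ j \<cdot>\<^sub>m (mat_adjoint v * mat_adjoint (T ^\<^sub>m (m - j)) * \<Sigma>1)"
      if "j \<le> m" for j
      using even_coefficient[OF that] by (simp only: v_def T_def \<Sigma>1_def add_0)
    have odd: "A (2 * j + 1) = (-1) ^ (j + 1) \<cdot>\<^sub>m (mat_adjoint u1 * mat_adjoint (T ^\<^sub>m (m - j - 1)) * \<Sigma>1)"
      if "j < m" for j
      using odd_coefficient_even_degree[OF refl that] by (simp only: u1_def T_def \<Sigma>1_def add_0)
    have last_even: "A (2 * m) = (-1) ^ m \<cdot>\<^sub>m (mat_adjoint v * \<Sigma>1)"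
      using even[of m] T0[OF v] by (simp only: diff_self_eq_0 order_refl)
    have last_odd: "A (2 * m - 1) = (-1) ^ m \<cdot>\<^sub>m (mat_adjoint u1 * \<Sigma>1)"
    proof -
      have "m - (m - 1) - 1 = 0" "2 * (m - 1) + 1 = 2 * m - 1" "m - 1 + 1 = m" using m by auto
      then show ?thesis using odd[of "m - 1"] T0[OF u] m by simp
    qed
    have P0: "mat_adjoint (P 1 0) = mat_adjoint v * \<Sigma>1"
      using adjoint_P_mat_zero by (simp only: P_def v_def \<Sigma>1_def add_0)
    have Q0: "mat_adjoint (Q 1 0) = - (mat_adjoint u1 * \<Sigma>1)"
      using adjoint_Q_mat_zero u by (simp only: Q_def u1_def \<Sigma>1_def add_0)
    have "(-1) ^ m \<cdot>\<^sub>m (mat_adjoint u1 * \<Sigma>1) = (-1) ^ (m + 1) \<cdot>\<^sub>m mat_adjoint (Q 1 0)"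
      unfolding Q0 by (rule eq_matI) (auto simp del: index_mult_mat(1))
    moreover have "1\<^sub>m q = mat_adjoint v * mat_adjoint (T ^\<^sub>m m) * \<Sigma>1"
      using even[of 0] by (simp add: A0 one)
    moreover have "A 1 = - (mat_adjoint u1 * mat_adjoint (T ^\<^sub>m (m - 1)) * \<Sigma>1)"
      using odd[of 0] m by (simp add: neg_one)
    ultimately show "(\<forall>j\<le>m. A (2 * j) =
          (-1) ^ j \<cdot>\<^sub>m (mat_adjoint v * mat_adjoint (T ^\<^sub>m (m - j)) * \<Sigma>1)) \<and>
       (\<forall>j<m. A (2 * j + 1) =
          (-1) ^ (j + 1) \<cdot>\<^sub>m (mat_adjoint u1 * mat_adjoint (T ^\<^sub>m (m - j - 1)) * \<Sigma>1)) \<and>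
       1\<^sub>m q = mat_adjoint v * mat_adjoint (T ^\<^sub>m m) * \<Sigma>1 \<and>
       A 1 = - (mat_adjoint u1 * mat_adjoint (T ^\<^sub>m (m - 1)) * \<Sigma>1) \<and>
       A 1 = s 0 \<and>
       A (2 * m - 1) = (-1) ^ m \<cdot>\<^sub>m (mat_adjoint u1 * \<Sigma>1) \<and>
       A (2 * m - 1) = (-1) ^ (m + 1) \<cdot>\<^sub>m mat_adjoint (Q 1 0) \<and>
       A (2 * m) = (-1) ^ m \<cdot>\<^sub>m (mat_adjoint v * \<Sigma>1) \<and>
       A (2 * m) = (-1) ^ m \<cdot>\<^sub>m mat_adjoint (P 1 0)"
      using even odd first_coefficient last_even last_odd P0 by (intro conjI allI impI; simp only:)
  }
  {
    assume n1: "n = 2 * m + 1"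
    interpret stieltjes_markov q m n 1 A s
      by unfold_locales (use assms(2,4,7,8) A_carrier n1 in auto)
    have two: "1 + 1 = (2 :: nat)" by simp
    have u: "u2 \<in> carrier_mat ((m + 1) * q) q"
      unfolding u2_def u2_mat_block_col[OF s_carrier] by (rule block_col_carrier)
    have even: "A (2 * j) = (-1) ^ j \<cdot>\<^sub>m (mat_adjoint v * mat_adjoint (T ^\<^sub>m (m - j)) * \<Sigma>2)"
      if "j \<le> m" for j
      using even_coefficient[OF that] by (simp only: v_def T_def \<Sigma>2_def two)
    have odd: "A (2 * j + 1) = (-1) ^ (j + 1) \<cdot>\<^sub>m (mat_adjoint u2 * mat_adjoint (T ^\<^sub>m (m - j)) * \<Sigma>2)"
      if "j \<le> m" for j
      using odd_coefficient_odd_degree[OF refl that] by (simp only: u2_def T_def \<Sigma>2_def two)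
    have last_even: "A (2 * m) = (-1) ^ m \<cdot>\<^sub>m (mat_adjoint v * \<Sigma>2)"
      using even[of m] T0[OF v] by (simp only: diff_self_eq_0 order_refl)
    have last_odd: "A (2 * m + 1) = (-1) ^ (m + 1) \<cdot>\<^sub>m (mat_adjoint u2 * \<Sigma>2)"
      using odd[of m] T0[OF u] by (simp only: diff_self_eq_0 order_refl)
    have P0: "mat_adjoint (P 2 0) = mat_adjoint v * \<Sigma>2"
      using adjoint_P_mat_zero by (simp only: P_def v_def \<Sigma>2_def two)
    have Q0: "mat_adjoint (Q 2 0) = - (mat_adjoint u2 * \<Sigma>2)"
      using adjoint_Q_mat_zero u by (simp only: Q_def u2_def \<Sigma>2_def two)
    have "(-1) ^ (m + 1) \<cdot>\<^sub>m (mat_adjoint u2 * \<Sigma>2) = (-1) ^ m \<cdot>\<^sub>m mat_adjoint (Q 2 0)"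
      unfolding Q0 by (rule eq_matI) (auto simp del: index_mult_mat(1))
    moreover have "1\<^sub>m q = mat_adjoint v * mat_adjoint (T ^\<^sub>m m) * \<Sigma>2"
      using even[of 0] by (simp add: A0 one)
    moreover have "A 1 = - (mat_adjoint u2 * mat_adjoint (T ^\<^sub>m m) * \<Sigma>2)"
      using odd[of 0] by (simp add: neg_one)
    ultimately show "(\<forall>j\<le>m. A (2 * j) =
          (-1) ^ j \<cdot>\<^sub>m (mat_adjoint v * mat_adjoint (T ^\<^sub>m (m - j)) * \<Sigma>2)) \<and>
       (\<forall>j\<le>m. A (2 * j + 1) =
          (-1) ^ (j + 1) \<cdot>\<^sub>m (mat_adjoint u2 * mat_adjoint (T ^\<^sub>m (m - j)) * \<Sigma>2)) \<and>
       1\<^sub>m q = mat_adjoint v * mat_adjoint (T ^\<^sub>m m) * \<Sigma>2 \<and>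
       A 1 = - (mat_adjoint u2 * mat_adjoint (T ^\<^sub>m m) * \<Sigma>2) \<and>
       A 1 = s 0 \<and>
       A (2 * m) = (-1) ^ m \<cdot>\<^sub>m (mat_adjoint v * \<Sigma>2) \<and>
       A (2 * m) = (-1) ^ m \<cdot>\<^sub>m mat_adjoint (P 2 0) \<and>
       A (2 * m + 1) = (-1) ^ (m + 1) \<cdot>\<^sub>m (mat_adjoint u2 * \<Sigma>2) \<and>
       A (2 * m + 1) = (-1) ^ m \<cdot>\<^sub>m mat_adjoint (Q 2 0)"
      using even odd first_coefficient last_even last_odd P0 by (intro conjI allI impI; simp only:)
  }
qed

end
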